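(* Let $r\colon D\otimes D\to D\otimes D$ be a $K$-linear map that induces by restriction a non-degenerate bijection $r_{|}\colon X\times X\to X\times X$, with associated coefficients $\lambda_{a|b|c|d}^{e|f|g|h}$ and maps $L_a,R_c\colon X\to X$. Assume that: (0) for all $a\le b$ and $c\le d$ in $X$, $\sum_{e,g\in X}\lambda_{a|b|c|d}^{e|e|g|g}=\delta_{ab}\delta_{cd}$; (1) for all $a,b\in X$ the maps $L_a$ and $R_b$ are automorphisms of the ordered set $X$; (2) if $a$ and $b$ belong to the same connected component of $X$, then $L_a=L_b$ and $R_a=R_b$; (3) if $a\le b$, $c\le d$, $e\le f$, $g\le h$ and $\lambda_{a|b|c|d}^{e|f|g|h}\neq 0$, then $R_c(a)\le g\le h\le R_c(b)$ and $L_a(c)\le e\le f\le L_a(d)$; (4) if $a\le b$, $c\le d$, $e\le f$, $g\le h$, $R_c(a)\le g\le h\le R_c(b)$ and $L_a(c)\le e\le f\le L_a(d)$, then for all $y,z\in X$ with $e\le y\le f$ and $g\le z\le h$, $$\lambda_{a|b|c|d}^{e|f|g|h}=\lambda_{a|R_c^{-1}(z)|c|L_a^{-1}(y)}^{e|y|g|z}\;\lambda_{R_c^{-1}(z)|b|L_a^{-1}(y)|d}^{y|f|z|h};$$ (5) $\lambda_{a|b|c|d}^{L_a(c)|L_a(d)|R_c(a)|R_c(b)}\in K^{\times}$ for all $(a,b),(c,d)\in Y$. Then $r$ is a non-degenerate coalgebra automorphism of $D\otimes D$.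
   Context: $K$ is a field and $\otimes=\otimes_K$. $(X,\le)$ is a locally finite poset, i.e. every interval $[a,b]=\{c\in X: a\le c\le b\}$ is finite. $Y=\{(a,b)\in X\times X: a\le b\}$ and $D=KY$ is the vector space with basis $Y$, with its incidence coalgebra structure $\Delta(a,b)=\sum_{c\in[a,b]}(a,c)\otimes(c,b)$, $\epsilon(a,b)=\delta_{ab}$. The connected components of $X$ are the classes of the equivalence relation generated by comparability. For a linear map $r\colon D\otimes D\to D\otimes D$ the coefficients $\lambda_{a|b|c|d}^{e|f|g|h}\in K$ (for $(a,b),(c,d),(e,f),(g,h)\in Y$) are defined by $r((a,b)\otimes(c,d))=\sum_{e\le f,\ g\le h}\lambda_{a|b|c|d}^{e|f|g|h}\,(e,f)\otimes(g,h)$. "$r$ induces by restriction $r_{|}\colon X\times X\to X\times X$" means that for all $a,c\in X$, $r((a,a)\otimes(c,c))=(e,e)\otimes(g,g)$ where $(e,g)=r_{|}(a,c)$. One writes $L_a(c)=e$ and $R_c(a)=g$ (the usual notation is ${}^a c=e$, $a^c=g$), i.e. $r_{|}(a,c)=(L_a(c),R_c(a))$. The bijection $r_{|}$ is non-degenerate if all the maps $L_a$ and $R_c$ are bijections of $X$. A coalgebra automorphism $r$ of $D\otimes D$ is non-degenerate if, with $\sigma=(D\otimes\epsilon)\circ r$ and $\tau=(\epsilon\otimes D)\circ r$, there exist linear maps $\bar\sigma,\bar\tau\colon D\otimes D\to D$ such that $\bar\sigma\circ(D\otimes\sigma)\circ(\Delta\otimes D)=\sigma\circ(D\otimes\bar\sigma)\circ(\Delta\otimes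 D)=\epsilon\otimes D$ and $\bar\tau\circ(\tau\otimes D)\circ(D\otimes\Delta)=\tau\circ(\bar\tau\otimes D)\circ(D\otimes\Delta)=D\otimes\epsilon$ (here $D$ denotes also the identity map of $D$). *)

theory Defs
  imports Complex_Main "HOL-Library.Poly_Mapping"
begin

section \<open>Free vector spaces and their tensor products\<close>

text \<open>
  The vector space \<open>KS\<close> with basis \<open>S\<close> is the type of finitely supported functions
  from \<open>S\<close> to the field \<open>K\<close>; the basis vector \<open>s\<close> is \<^term>\<open>Poly_Mapping.single s 1\<close>.
\<close>

abbreviation "lookup \<equiv> Poly_Mapping.lookup"
abbreviation "keys \<equiv> Poly_Mapping.keys"

definition scale :: "'k::field \<Rightarrow> ('s \<Rightarrow>\<^sub>0 'k) \<Rightarrow> ('s \<Rightarrow>\<^sub>0 'k)" (infixr \<open>*\<^sub>K\<close> 75)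
  where "c *\<^sub>K v = Poly_Mapping.map (\<lambda>x. c * x) v"

lemma lookup_scale [simp]: "lookup (c *\<^sub>K v) s = c * lookup v s"
  by (cases "lookup v s = 0") (simp_all add: scale_def Poly_Mapping.map.rep_eq when_def)

interpretation free_vs: vector_space "scale :: 'k::field \<Rightarrow> ('s \<Rightarrow>\<^sub>0 'k) \<Rightarrow> _"
  by unfold_locales (auto intro!: poly_mapping_eqI simp: lookup_add algebra_simps)

interpretation field_vs: vector_space "(*) :: 'k::field \<Rightarrow> 'k \<Rightarrow> 'k"
  by unfold_locales (auto simp: algebra_simps)

abbreviation basis_vec :: "'s \<Rightarrow> ('s \<Rightarrow>\<^sub>0 'k::field)"
  where "basis_vec s \<equiv> Poly_Mapping.single s 1"

abbreviation linear_map :: "(('s \<Rightarrow>\<^sub>0 'k::field) \<Rightarrow> ('t \<Rightarrow>\<^sub>0 'k)) \<Rightarrow> bool"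
  where "linear_map \<equiv> Vector_Spaces.linear scale scale"

abbreviation linear_form :: "(('s \<Rightarrow>\<^sub>0 'k::field) \<Rightarrow> 'k) \<Rightarrow> bool"
  where "linear_form \<equiv> Vector_Spaces.linear scale (*)"

text \<open>The linear map with prescribed values \<open>g\<close> on the basis; \<open>sc\<close> is the scalar
  multiplication of the target space.\<close>

definition lin_ext :: "('k::field \<Rightarrow> 'v::ab_group_add \<Rightarrow> 'v) \<Rightarrow> ('s \<Rightarrow> 'v) \<Rightarrow> ('s \<Rightarrow>\<^sub>0 'k) \<Rightarrow> 'v"
  where "lin_ext sc g v = (\<Sum>s\<in>keys v. sc (lookup v s) (g s))"

text \<open>\<open>KS \<otimes> KT\<close> is modelled as \<open>K(S \<times> T)\<close>; see \<open>tensor_universal\<close> below.\<close>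

definition tensor :: "('s \<Rightarrow>\<^sub>0 'k::field) \<Rightarrow> ('t \<Rightarrow>\<^sub>0 'k) \<Rightarrow> ('s \<times> 't \<Rightarrow>\<^sub>0 'k)" (infixr \<open>\<otimes>\<close> 72)
  where "v \<otimes> w = (\<Sum>s\<in>keys v. \<Sum>t\<in>keys w. Poly_Mapping.single (s, t) (lookup v s * lookup w t))"

text \<open>\<open>f \<otimes> g\<close> for linear maps, and the variants where \<open>f\<close> or \<open>g\<close> is a linear form and the
  target is identified with a smaller space along \<open>V \<otimes> K = V = K \<otimes> V\<close>, \<open>K \<otimes> K = K\<close>.\<close>

definition tensor_map ::
  "(('s \<Rightarrow>\<^sub>0 'k::field) \<Rightarrow> ('u \<Rightarrow>\<^sub>0 'k)) \<Rightarrow> (('t \<Rightarrow>\<^sub>0 'k) \<Rightarrow> ('v \<Rightarrow>\<^sub>0 'k)) \<Rightarrow>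
   ('s \<times> 't \<Rightarrow>\<^sub>0 'k) \<Rightarrow> ('u \<times> 'v \<Rightarrow>\<^sub>0 'k)" (infixr \<open>\<otimes>\<^sub>m\<close> 72)
  where "f \<otimes>\<^sub>m g = lin_ext scale (\<lambda>(s, t). f (basis_vec s) \<otimes> g (basis_vec t))"

definition tensor_map_form ::
  "(('s \<Rightarrow>\<^sub>0 'k::field) \<Rightarrow> ('u \<Rightarrow>\<^sub>0 'k)) \<Rightarrow> (('t \<Rightarrow>\<^sub>0 'k) \<Rightarrow> 'k) \<Rightarrow>
   ('s \<times> 't \<Rightarrow>\<^sub>0 'k) \<Rightarrow> ('u \<Rightarrow>\<^sub>0 'k)" (infixr \<open>\<otimes>\<^sub>r\<close> 72)
  where "f \<otimes>\<^sub>r \<phi> = lin_ext scale (\<lambda>(s, t). \<phi> (basis_vec t) *\<^sub>K f (basis_vec s))"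

definition tensor_form_map ::
  "(('s \<Rightarrow>\<^sub>0 'k::field) \<Rightarrow> 'k) \<Rightarrow> (('t \<Rightarrow>\<^sub>0 'k) \<Rightarrow> ('v \<Rightarrow>\<^sub>0 'k)) \<Rightarrow>
   ('s \<times> 't \<Rightarrow>\<^sub>0 'k) \<Rightarrow> ('v \<Rightarrow>\<^sub>0 'k)" (infixr \<open>\<otimes>\<^sub>l\<close> 72)
  where "\<phi> \<otimes>\<^sub>l g = lin_ext scale (\<lambda>(s, t). \<phi> (basis_vec s) *\<^sub>K g (basis_vec t))"

definition tensor_form ::
  "(('s \<Rightarrow>\<^sub>0 'k::field) \<Rightarrow> 'k) \<Rightarrow> (('t \<Rightarrow>\<^sub>0 'k) \<Rightarrow> 'k) \<Rightarrow> ('s \<times> 't \<Rightarrow>\<^sub>0 'k) \<Rightarrow> 'k"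
  (infixr \<open>\<otimes>\<^sub>f\<close> 72)
  where "\<phi> \<otimes>\<^sub>f \<psi> = lin_ext (*) (\<lambda>(s, t). \<phi> (basis_vec s) * \<psi> (basis_vec t))"

text \<open>Rebracketing isomorphisms, and the interchange \<open>(A \<otimes> B) \<otimes> (C \<otimes> D) \<cong> (A \<otimes> C) \<otimes> (B \<otimes> D)\<close>.\<close>

definition tensor_assoc :: "(('s \<times> 't) \<times> 'u \<Rightarrow>\<^sub>0 'k::field) \<Rightarrow> ('s \<times> ('t \<times> 'u) \<Rightarrow>\<^sub>0 'k)"
  where "tensor_assoc = lin_ext scale (\<lambda>((s, t), u). basis_vec (s, (t, u)))"

definition tensor_assoc' :: "('s \<times> ('t \<times> 'u) \<Rightarrow>\<^sub>0 'k::field) \<Rightarrow> (('s \<times> 't) \<times> 'u \<Rightarrow>\<^sub>0 'k)"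
  where "tensor_assoc' = lin_ext scale (\<lambda>(s, (t, u)). basis_vec ((s, t), u))"

definition tensor_interchange ::
  "(('s \<times> 't) \<times> ('u \<times> 'v) \<Rightarrow>\<^sub>0 'k::field) \<Rightarrow> (('s \<times> 'u) \<times> ('t \<times> 'v) \<Rightarrow>\<^sub>0 'k)"
  where "tensor_interchange = lin_ext scale (\<lambda>((s, t), (u, v)). basis_vec ((s, u), (t, v)))"


subsection \<open>Adequacy of the tensor product\<close>

lemma lin_ext_superset:
  assumes "vector_space sc" "finite A" "keys v \<subseteq> A"
  shows "lin_ext sc g v = (\<Sum>s\<in>A. sc (lookup v s) (g s))"
proof -
  interpret vector_space sc by fact
  show ?thesis
    unfolding lin_ext_def
    by (rule sum.mono_neutral_left) (use assms in \<open>auto simp: in_keys_iff\<close>)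
qed

lemma linear_lin_ext:
  fixes sc :: "'k::field \<Rightarrow> 'v::ab_group_add \<Rightarrow> 'v" and g :: "'s \<Rightarrow> 'v"
  assumes "vector_space sc"
  shows "Vector_Spaces.linear scale sc (lin_ext sc g)"
proof -
  interpret S: vector_space sc by fact
  have add: "lin_ext sc g (v + w) = lin_ext sc g v + lin_ext sc g w" for v w
  proof -
    let ?A = "keys v \<union> keys w"
    have "keys (v + w) \<subseteq> ?A" by (rule keys_add)
    then show ?thesis
      by (simp add: lin_ext_superset[OF assms, of ?A] lookup_add S.scale_left_distrib
          sum.distrib)
  qed
  have scl: "lin_ext sc g (c *\<^sub>K v) = sc c (lin_ext sc g v)" for c v
  proof -
    have "keys (c *\<^sub>K v) \<subseteq> keys v" by (auto simp: in_keys_iff)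
    then show ?thesis
      by (simp add: lin_ext_superset[OF assms, of "keys v"] S.scale_sum_right)
  qed
  show ?thesis by unfold_locales (fact add scl)+
qed

lemma lin_ext_basis [simp]:
  assumes "vector_space sc"
  shows "lin_ext sc g (basis_vec s) = g s"
proof -
  interpret vector_space sc by fact
  show ?thesis by (simp add: lin_ext_def)
qed

lemma basis_expansion: "v = (\<Sum>s\<in>keys v. lookup v s *\<^sub>K basis_vec s)"
proof (rule poly_mapping_eqI)
  fix t
  show "lookup v t = lookup (\<Sum>s\<in>keys v. lookup v s *\<^sub>K basis_vec s) t"
    by (cases "t \<in> keys v")
       (auto simp: lookup_sum lookup_single when_def if_distrib in_keys_iff
          cong: if_cong)
qed

lemma linear_eq_lin_ext:
  fixes f :: "('s \<Rightarrow>\<^sub>0 'k::field) \<Rightarrow> 'v::ab_group_add"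
  assumes "Vector_Spaces.linear scale sc f"
  shows "f = lin_ext sc (\<lambda>s. f (basis_vec s))"
proof
  fix v
  interpret Vector_Spaces.linear scale sc f by fact
  show "f v = lin_ext sc (\<lambda>s. f (basis_vec s)) v"
    by (subst basis_expansion[of v]) (simp add: lin_ext_def sum scale)
qed

lemma lookup_tensor [simp]: "lookup (v \<otimes> w) (s, t) = lookup v s * lookup w t"
proof -
  have "lookup (v \<otimes> w) (s, t) =
    (\<Sum>s'\<in>keys v. \<Sum>t'\<in>keys w. if s' = s \<and> t' = t then lookup v s * lookup w t else 0)"
    unfolding tensor_def lookup_sum lookup_single
    by (intro sum.cong refl) (auto simp: when_def)
  also have "\<dots> = (\<Sum>s'\<in>keys v. if s' = s then
      (\<Sum>t'\<in>keys w. if t' = t then lookup v s * lookup w t else 0) else 0)"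
    by (intro sum.cong refl) auto
  also have "\<dots> = lookup v s * lookup w t"
    by (auto simp: in_keys_iff)
  finally show ?thesis .
qed

lemma tensor_basis [simp]: "basis_vec s \<otimes> basis_vec t = basis_vec (s, t)"
  by (simp add: tensor_def)

text \<open>The universal property: bilinear maps out of \<open>KS \<times> KT\<close> factor uniquely through \<open>\<otimes>\<close>.\<close>

lemma tensor_universal:
  fixes B :: "('s \<Rightarrow>\<^sub>0 'k::field) \<Rightarrow> ('t \<Rightarrow>\<^sub>0 'k) \<Rightarrow> 'v::ab_group_add"
  assumes sc: "vector_space sc"
    and B1: "\<And>w. Vector_Spaces.linear scale sc (\<lambda>v. B v w)"
    and B2: "\<And>v. Vector_Spaces.linear scale sc (B v)"
  shows "\<exists>!f. Vector_Spaces.linear scale sc f \<and> (\<forall>v w. f (v \<otimes> w) = B v w)"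
proof (rule ex1I)
  interpret S: vector_space sc by fact
  let ?g = "\<lambda>(s, t). B (basis_vec s) (basis_vec t)"
  have "lin_ext sc ?g (v \<otimes> w) = B v w" for v w
  proof -
    have "keys (v \<otimes> w) \<subseteq> keys v \<times> keys w"
      by (auto simp: in_keys_iff)
    then have "lin_ext sc ?g (v \<otimes> w) =
      (\<Sum>x\<in>keys v \<times> keys w. sc (lookup (v \<otimes> w) x) (?g x))"
      by (intro lin_ext_superset sc) auto
    also have "\<dots> = (\<Sum>s\<in>keys v. \<Sum>t\<in>keys w. sc (lookup v s * lookup w t) (B (basis_vec s) (basis_vec t)))"
      by (simp add: sum.cartesian_product case_prod_beta' split: prod.split)
         (intro sum.cong refl, auto)
    also have "\<dots> = (\<Sum>s\<in>keys v. sc (lookup v s) (B (basis_vec s) w))"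
      by (intro sum.cong refl, subst linear_eq_lin_ext[OF B2])
         (simp add: lin_ext_def S.scale_sum_right)
    also have "\<dots> = B v w"
      using fun_cong[OF linear_eq_lin_ext[OF B1[of w]], of v] by (simp add: lin_ext_def)
    finally show ?thesis .
  qed
  then show "Vector_Spaces.linear scale sc (lin_ext sc ?g) \<and>
      (\<forall>v w. lin_ext sc ?g (v \<otimes> w) = B v w)"
    using linear_lin_ext[OF sc] by blast
  fix f
  assume f: "Vector_Spaces.linear scale sc f \<and> (\<forall>v w. f (v \<otimes> w) = B v w)"
  then have "(\<lambda>x. f (basis_vec x)) = ?g"
    by (auto simp flip: tensor_basis)
  with linear_eq_lin_ext[of sc f] f show "f = lin_ext sc ?g" by simp
qed


section \<open>Coalgebra maps\<close>

text \<open>A coalgebra structure on \<open>KS\<close> is given by its comultiplication \<open>\<Delta>\<close> and counit \<open>\<epsilon>\<close>.\<close>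

definition coalgebra_hom ::
  "(('s \<Rightarrow>\<^sub>0 'k::field) \<Rightarrow> ('s \<times> 's \<Rightarrow>\<^sub>0 'k)) \<Rightarrow> (('s \<Rightarrow>\<^sub>0 'k) \<Rightarrow> 'k) \<Rightarrow>
   (('t \<Rightarrow>\<^sub>0 'k) \<Rightarrow> ('t \<times> 't \<Rightarrow>\<^sub>0 'k)) \<Rightarrow> (('t \<Rightarrow>\<^sub>0 'k) \<Rightarrow> 'k) \<Rightarrow>
   (('s \<Rightarrow>\<^sub>0 'k) \<Rightarrow> ('t \<Rightarrow>\<^sub>0 'k)) \<Rightarrow> bool"
  where "coalgebra_hom \<Delta> \<epsilon> \<Delta>' \<epsilon>' f \<longleftrightarrow>
    linear_map f \<and> \<Delta>' \<circ> f = (f \<otimes>\<^sub>m f) \<circ> \<Delta> \<and> \<epsilon>' \<circ> f = \<epsilon>"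

definition coalgebra_automorphism ::
  "(('s \<Rightarrow>\<^sub>0 'k::field) \<Rightarrow> ('s \<times> 's \<Rightarrow>\<^sub>0 'k)) \<Rightarrow> (('s \<Rightarrow>\<^sub>0 'k) \<Rightarrow> 'k) \<Rightarrow>
   (('s \<Rightarrow>\<^sub>0 'k) \<Rightarrow> ('s \<Rightarrow>\<^sub>0 'k)) \<Rightarrow> bool"
  where "coalgebra_automorphism \<Delta> \<epsilon> f \<longleftrightarrow> coalgebra_hom \<Delta> \<epsilon> \<Delta> \<epsilon> f \<and> bij f"

definition tensor_comult ::
  "(('s \<Rightarrow>\<^sub>0 'k::field) \<Rightarrow> ('s \<times> 's \<Rightarrow>\<^sub>0 'k)) \<Rightarrow> (('t \<Rightarrow>\<^sub>0 'k) \<Rightarrow> ('t \<times> 't \<Rightarrow>\<^sub>0 'k)) \<Rightarrow>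
   ('s \<times> 't \<Rightarrow>\<^sub>0 'k) \<Rightarrow> (('s \<times> 't) \<times> ('s \<times> 't) \<Rightarrow>\<^sub>0 'k)"
  where "tensor_comult \<Delta> \<Delta>' = tensor_interchange \<circ> (\<Delta> \<otimes>\<^sub>m \<Delta>')"

text \<open>Non-degeneracy of an endomorphism \<open>r\<close> of \<open>D \<otimes> D\<close>, where \<open>D\<close> has structure \<open>\<Delta>\<close>, \<open>\<epsilon>\<close>.\<close>

definition nondegenerate ::
  "(('s \<Rightarrow>\<^sub>0 'k::field) \<Rightarrow> ('s \<times> 's \<Rightarrow>\<^sub>0 'k)) \<Rightarrow> (('s \<Rightarrow>\<^sub>0 'k) \<Rightarrow> 'k) \<Rightarrow>
   (('s \<times> 's \<Rightarrow>\<^sub>0 'k) \<Rightarrow> ('s \<times> 's \<Rightarrow>\<^sub>0 'k)) \<Rightarrow> bool"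
  where "nondegenerate \<Delta> \<epsilon> r \<longleftrightarrow>
    (let \<sigma> = (id \<otimes>\<^sub>r \<epsilon>) \<circ> r; \<tau> = (\<epsilon> \<otimes>\<^sub>l id) \<circ> r in
     \<exists>\<sigma>' \<tau>'. linear_map \<sigma>' \<and> linear_map \<tau>' \<and>
       \<sigma>' \<circ> (id \<otimes>\<^sub>m \<sigma>) \<circ> tensor_assoc \<circ> (\<Delta> \<otimes>\<^sub>m id) = \<epsilon> \<otimes>\<^sub>l id \<and>
       \<sigma> \<circ> (id \<otimes>\<^sub>m \<sigma>') \<circ> tensor_assoc \<circ> (\<Delta> \<otimes>\<^sub>m id) = \<epsilon> \<otimes>\<^sub>l id \<and>
       \<tau>' \<circ> (\<tau> \<otimes>\<^sub>m id) \<circ> tensor_assoc' \<circ> (id \<otimes>\<^sub>m \<Delta>) = id \<otimes>\<^sub>r \<epsilon> \<and>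
       \<tau> \<circ> (\<tau>' \<otimes>\<^sub>m id) \<circ> tensor_assoc' \<circ> (id \<otimes>\<^sub>m \<Delta>) = id \<otimes>\<^sub>r \<epsilon>)"


section \<open>The incidence coalgebra of a poset\<close>

text \<open>\<open>'a intv\<close> is the set \<open>Y\<close> of pairs \<open>(a, b)\<close> with \<open>a \<le> b\<close>, and \<open>D = KY\<close>.\<close>

typedef (overloaded) ('a::order) intv = "{(a :: 'a, b). a \<le> b}"
  by (rule exI[of _ "(undefined, undefined)"]) simp

text \<open>Only meaningful for \<open>a \<le> b\<close>.\<close>

definition ivl :: "'a::order \<Rightarrow> 'a \<Rightarrow> 'a intv"
  where "ivl a b = Abs_intv (a, b)"

definition lower :: "'a::order intv \<Rightarrow> 'a"
  where "lower p = fst (Rep_intv p)"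

definition upper :: "'a::order intv \<Rightarrow> 'a"
  where "upper p = snd (Rep_intv p)"

lemma lower_le_upper: "lower p \<le> upper p"
  using Rep_intv[of p] by (auto simp: lower_def upper_def)

lemma ivl_lower_upper [simp]: "ivl (lower p) (upper p) = p"
  by (simp add: ivl_def lower_def upper_def Rep_intv_inverse)

lemma lower_ivl [simp]: "a \<le> b \<Longrightarrow> lower (ivl a b) = a"
  and upper_ivl [simp]: "a \<le> b \<Longrightarrow> upper (ivl a b) = b"
  by (simp_all add: ivl_def lower_def upper_def Abs_intv_inverse)

type_synonym ('a, 'k) incidence = "'a intv \<Rightarrow>\<^sub>0 'k"

definition inc_comult ::
  "('a::order, 'k::field) incidence \<Rightarrow> ('a intv \<times> 'a intv \<Rightarrow>\<^sub>0 'k)"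
  where "inc_comult = lin_ext scale
    (\<lambda>p. \<Sum>c\<in>{lower p..upper p}. basis_vec (ivl (lower p) c) \<otimes> basis_vec (ivl c (upper p)))"

definition inc_counit :: "('a::order, 'k::field) incidence \<Rightarrow> 'k"
  where "inc_counit = lin_ext (*) (\<lambda>p. if lower p = upper p then 1 else 0)"

definition locally_finite :: "'a::order itself \<Rightarrow> bool"
  where "locally_finite _ \<longleftrightarrow> (\<forall>a b :: 'a. finite {a..b})"

definition same_component :: "'a::order \<Rightarrow> 'a \<Rightarrow> bool"
  where "same_component = equivclp (\<le>)"

definition order_automorphism :: "('a::order \<Rightarrow> 'a) \<Rightarrow> bool"
  where "order_automorphism f \<longleftrightarrow> bij f \<and> (\<forall>x y. f x \<le> f y \<longleftrightarrow> x \<le> y)"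


section \<open>Endomorphisms of the tensor square of the incidence coalgebra\<close>

text \<open>The coefficient \<open>\<lambda>\<close> of \<open>(e, f) \<otimes> (g, h)\<close> in \<open>r ((a, b) \<otimes> (c, d))\<close>; for arguments which
  are not pairs in \<open>Y\<close> we set it to \<open>0\<close>.\<close>

definition coefficient ::
  "(('a::order intv \<times> 'a intv \<Rightarrow>\<^sub>0 'k::field) \<Rightarrow> ('a intv \<times> 'a intv \<Rightarrow>\<^sub>0 'k)) \<Rightarrow>
   'a \<Rightarrow> 'a \<Rightarrow> 'a \<Rightarrow> 'a \<Rightarrow> 'a \<Rightarrow> 'a \<Rightarrow> 'a \<Rightarrow> 'a \<Rightarrow> 'k"
  where "coefficient r a b c d e f g h =
    (if a \<le> b \<and> c \<le> d \<and> e \<le> f \<and> g \<le> h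
     then lookup (r (basis_vec (ivl a b) \<otimes> basis_vec (ivl c d))) (ivl e f, ivl g h) else 0)"

definition induces_by_restriction ::
  "(('a::order intv \<times> 'a intv \<Rightarrow>\<^sub>0 'k::field) \<Rightarrow> ('a intv \<times> 'a intv \<Rightarrow>\<^sub>0 'k)) \<Rightarrow>
   ('a \<times> 'a \<Rightarrow> 'a \<times> 'a) \<Rightarrow> bool"
  where "induces_by_restriction r r0 \<longleftrightarrow>
    (\<forall>a c. case r0 (a, c) of (e, g) \<Rightarrow>
       r (basis_vec (ivl a a) \<otimes> basis_vec (ivl c c)) = basis_vec (ivl e e) \<otimes> basis_vec (ivl g g))"

text \<open>\<open>r0 (a, c) = (left_map r0 a c, right_map r0 c a)\<close>: the index of each map is its first argument.\<close>

definition left_map :: "('a \<times> 'a \<Rightarrow> 'a \<times> 'a) \<Rightarrow> 'a \<Rightarrow> 'a \<Rightarrow> 'a"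
  where "left_map r0 a c = fst (r0 (a, c))"

definition right_map :: "('a \<times> 'a \<Rightarrow> 'a \<times> 'a) \<Rightarrow> 'a \<Rightarrow> 'a \<Rightarrow> 'a"
  where "right_map r0 c a = snd (r0 (a, c))"

definition nondegenerate_bij :: "('a \<times> 'a \<Rightarrow> 'a \<times> 'a) \<Rightarrow> bool"
  where "nondegenerate_bij r0 \<longleftrightarrow>
    bij r0 \<and> (\<forall>a. bij (left_map r0 a)) \<and> (\<forall>c. bij (right_map r0 c))"

end

theory Submission
  imports Defs
begin

text \<open>
  With respect to inclusion of intervals, \<open>r\<close> and the maps \<open>v \<mapsto> \<sigma> ((a, a) \<otimes> v)\<close>,
  \<open>v \<mapsto> \<tau> (v \<otimes> (c, c))\<close> are triangular up to a bijection of the bases, with the nonzero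
  coefficients of (5) on the diagonal; so they are bijective. For \<open>\<sigma>\<close> and \<open>\<tau>\<close>
  the required identities say that \<open>(a, b) \<mapsto> \<sigma> ((a, b) \<otimes> _)\<close> is invertible in the incidence algebra of
  \<open>X\<close> with values in \<open>End D\<close> (with the opposite order for \<open>\<tau>\<close>), which
  only needs invertible diagonal values.

  By (4), comparing coefficients in \<open>\<Delta> \<circ> r = (r \<otimes> r) \<circ> \<Delta>\<close> reduces to
  \<open>\<beta> * \<alpha> = \<delta>\<close> in the incidence algebra of \<open>X \<times> X\<close>, where \<open>\<alpha>\<close> and \<open>\<beta>\<close>
  collect the coefficients of \<open>r ((a, b) \<otimes> (c, d))\<close> at the largest and at the smallest pair of degenerate
  intervals. Condition (0) says \<open>\<alpha> * \<beta> = \<delta>\<close>, and one-sided inverses in incidence algebras are two-sided.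
\<close>

section \<open>Triangular linear maps\<close>

lemma linear_eq_on_basis:
  fixes f g :: "('s \<Rightarrow>\<^sub>0 'k::field) \<Rightarrow> 'v::ab_group_add"
  assumes "Vector_Spaces.linear scale sc f" "Vector_Spaces.linear scale sc g"
    and "\<And>s. f (basis_vec s) = g (basis_vec s)"
  shows "f = g"
  using assms(3) by (subst linear_eq_lin_ext[OF assms(1)], subst linear_eq_lin_ext[OF assms(2)]) simp

lemma lookup_linear:
  fixes f :: "('s \<Rightarrow>\<^sub>0 'k::field) \<Rightarrow> ('t \<Rightarrow>\<^sub>0 'k)"
  assumes "linear_map f" "finite A" "keys v \<subseteq> A"
  shows "lookup (f v) t = (\<Sum>s\<in>A. lookup v s * lookup (f (basis_vec s)) t)"
  by (subst linear_eq_lin_ext[OF assms(1)])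
    (simp add: lin_ext_superset[OF free_vs.vector_space_axioms assms(2,3)] lookup_sum)

text \<open>An element of the kernel would have a nonzero coefficient at its key of largest measure,
  so \<open>f\<close> is injective. For surjectivity, induction on \<open>m s\<close> solves
  \<open>f (basis_vec s)\<close> for \<open>basis_vec (\<theta> s)\<close>, all other terms having
  smaller measure.\<close>

lemma triangular_bij:
  fixes f :: "('s \<Rightarrow>\<^sub>0 'k::field) \<Rightarrow> ('t \<Rightarrow>\<^sub>0 'k)" and \<theta> :: "'s \<Rightarrow> 't" and m :: "'s \<Rightarrow> nat"
  assumes lin: "linear_map f" and bij: "bij \<theta>"
    and diag: "\<And>s. lookup (f (basis_vec s)) (\<theta> s) \<noteq> 0"
    and tri: "\<And>s t. lookup (f (basis_vec s)) (\<theta> t) \<noteq> 0 \<Longrightarrow> t \<noteq> s \<Longrightarrow> m t < m s"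
  shows "bij f"
proof -
  interpret f: Vector_Spaces.linear scale scale f by fact
  have "v = 0" if "f v = 0" for v
  proof (rule ccontr)
    assume "v \<noteq> 0"
    then have "keys v \<noteq> {}" by simp
    then obtain s where s: "s \<in> keys v" "\<And>t. t \<in> keys v \<Longrightarrow> m t \<le> m s"
      using Max_in[of "m ` keys v"] Max_ge[of "m ` keys v"] by fastforce
    have "0 = (\<Sum>t\<in>keys v. lookup v t * lookup (f (basis_vec t)) (\<theta> s))"
      using that lookup_linear[OF lin finite_keys subset_refl, of v "\<theta> s"] by simp
    \<comment> \<open>A further nonzero term \<open>t\<close> would need \<open>m s < m t\<close>,
      against the choice of \<open>s\<close>.\<close>
    also have "\<dots> = (\<Sum>t\<in>{s}. lookup v t * lookup (f (basis_vec t)) (\<theta> s))"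
      using s tri[of _ s] by (intro sum.mono_neutral_right) (auto, fastforce)
    finally show False
      using s diag[of s] by (simp add: in_keys_iff)
  qed
  then have "inj f"
    using f.inj_iff_eq_0 by blast
  have sub: "free_vs.subspace (range f)"
    using f.subspace_image[OF free_vs.subspace_UNIV] by simp
  have basis: "basis_vec (\<theta> s) \<in> range f" for s
  proof (induction s rule: measure_induct_rule[of m])
    case (less s)
    let ?w = "f (basis_vec s)" and ?t = "\<theta> s"
    have "?w = (\<Sum>t\<in>keys ?w. lookup ?w t *\<^sub>K basis_vec t)"
      by (rule basis_expansion)
    also have "\<dots> = lookup ?w ?t *\<^sub>K basis_vec ?t + (\<Sum>t\<in>keys ?w - {?t}. lookup ?w t *\<^sub>K basis_vec t)"
      using diag[of s] by (intro sum.remove) (auto simp: in_keys_iff)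
    finally have *: "lookup ?w ?t *\<^sub>K basis_vec ?t = ?w - (\<Sum>t\<in>keys ?w - {?t}. lookup ?w t *\<^sub>K basis_vec t)"
      by (simp add: eq_diff_eq)
    have "basis_vec t \<in> range f" if "t \<in> keys ?w - {?t}" for t
    proof -
      obtain t' where "t = \<theta> t'" using bij by (metis bij_pointE)
      with that tri[of s t'] less show ?thesis by (auto simp: in_keys_iff)
    qed
    then have "?w - (\<Sum>t\<in>keys ?w - {?t}. lookup ?w t *\<^sub>K basis_vec t) \<in> range f"
      by (intro free_vs.subspace_diff free_vs.subspace_sum free_vs.subspace_scale sub rangeI) auto
    then have "inverse (lookup ?w ?t) *\<^sub>K (lookup ?w ?t *\<^sub>K basis_vec ?t) \<in> range f"
      unfolding * by (rule free_vs.subspace_scale[OF sub])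
    then show ?case using diag[of s] by simp
  qed
  have "v \<in> range f" for v
  proof -
    have "(\<Sum>t\<in>keys v. lookup v t *\<^sub>K basis_vec t) \<in> range f"
      using basis bij by (intro free_vs.subspace_sum free_vs.subspace_scale sub) (metis bij_pointE)
    then show ?thesis by (subst basis_expansion)
  qed
  with \<open>inj f\<close> show ?thesis by (auto simp: bij_def)
qed

section \<open>Convolution over a locally finite order\<close>

text \<open>The order is an explicit relation because three orders are substituted for it:
  \<open>(\<le>)\<close> and \<open>(\<ge>)\<close> on one poset, and the componentwise order on
  pairs.\<close>

locale locally_finite_order =
  fixes le :: "'i \<Rightarrow> 'i \<Rightarrow> bool"
  assumes le_refl: "le a a"
    and le_antisym: "le a b \<Longrightarrow> le b a \<Longrightarrow> a = b"
    and le_trans: "le a b \<Longrightarrow> le b c \<Longrightarrow> le a c"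
    and finite_interval: "finite {c. le a c \<and> le c b}"
begin

definition between :: "'i \<Rightarrow> 'i \<Rightarrow> 'i set"
  where "between a b = {c. le a c \<and> le c b}"

lemma finite_between [simp]: "finite (between a b)"
  by (simp add: between_def finite_interval)

lemma card_between_less:
  assumes "c \<in> between a b" "c \<noteq> a"
  shows "card (between c b) < card (between a b)"
proof (rule psubset_card_mono)
  have "between c b \<subseteq> between a b"
    using assms by (auto simp: between_def intro: le_trans)
  moreover have "a \<in> between a b - between c b"
    using assms by (auto simp: between_def intro: le_refl le_trans le_antisym)
  ultimately show "between c b \<subset> between a b" by auto
qed simp

lemma sum_between_remove:
  fixes x :: "'i \<Rightarrow> 'v::ab_group_add"
  assumes "le a b"
  shows "(\<Sum>c\<in>between a b. x c) = x a + (\<Sum>c\<in>between a b - {a}. x c)"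
  using assms by (intro sum.remove) (auto simp: between_def le_refl finite_interval)

text \<open>Induction on the size of the interval from \<open>a\<close> to \<open>b\<close>: the
  values of \<open>x\<close> strictly above \<open>a\<close> already vanish, so only the diagonal
  term of the sum at \<open>a\<close> is left. Thus convolution with \<open>s\<close> can be
  cancelled on the left.\<close>

lemma convolution_eq_0D:
  fixes s :: "'i \<Rightarrow> 'i \<Rightarrow> 'v::ab_group_add \<Rightarrow> 'v"
  assumes "\<And>a v. s a a v = 0 \<Longrightarrow> v = 0" and "\<And>a c. s a c 0 = 0"
    and "\<And>a. le a b \<Longrightarrow> (\<Sum>c\<in>between a b. s a c (x c)) = 0"
    and "le a b"
  shows "x a = 0"
  using \<open>le a b\<close>
proof (induction a rule: measure_induct_rule[of "\<lambda>a. card (between a b)"])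
  case (less a)
  have "x c = 0" if "c \<in> between a b - {a}" for c
    using that less.IH[of c] card_between_less[of c a b] by (auto simp: between_def)
  then have "s a a (x a) = 0"
    using assms(3)[OF less.prems] by (simp add: sum_between_remove[OF less.prems] assms(2))
  then show ?case by (rule assms(1))
qed

text \<open>For \<open>x = w * s - \<delta>\<close>, associativity of convolution and
  \<open>s * w = \<delta>\<close> give \<open>s * x = s - s = 0\<close>, and \<open>s\<close> can be
  cancelled.\<close>

lemma left_inverse_if_right_inverse:
  fixes s w :: "'i \<Rightarrow> 'i \<Rightarrow> 'v::ab_group_add \<Rightarrow> 'v"
  assumes inj: "\<And>a v. s a a v = 0 \<Longrightarrow> v = 0" and add: "\<And>a c. additive (s a c)"
    and right: "\<And>a b v. le a b \<Longrightarrow> (\<Sum>c\<in>between a b. s a c (w c b v)) = (if a = b then v else 0)"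
    and "le a b"
  shows "(\<Sum>c\<in>between a b. w a c (s c b v)) = (if a = b then v else 0)"
proof -
  define x where "x a = (\<Sum>c\<in>between a b. w a c (s c b v)) - (if a = b then v else 0)" for a
  have "x a = 0"
  proof (rule convolution_eq_0D[OF inj])
    fix a assume ab: "le a b"
    have "(\<Sum>c\<in>between a b. s a c (x c)) =
        (\<Sum>c\<in>between a b. (\<Sum>d\<in>between c b. s a c (w c d (s d b v))) - (if c = b then s a b v else 0))"
      by (intro sum.cong refl)
        (auto simp: x_def additive.diff[OF add] additive.sum[OF add] additive.zero[OF add])
    also have "\<dots> = (\<Sum>c\<in>between a b. \<Sum>d\<in>between c b. s a c (w c d (s d b v))) - s a b v"
      using ab by (simp add: sum_subtractf between_def le_refl finite_interval)
    \<comment> \<open>Associativity: both double sums run over the chains from \<open>a\<close>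
      through \<open>c\<close> and \<open>d\<close> to \<open>b\<close>.\<close>
    also have "(\<Sum>c\<in>between a b. \<Sum>d\<in>between c b. s a c (w c d (s d b v))) =
        (\<Sum>d\<in>between a b. \<Sum>c\<in>between a d. s a c (w c d (s d b v)))"
      unfolding sum.Sigma[OF finite_between, OF ballI, OF finite_between]
      by (intro sum.reindex_bij_witness[of _ prod.swap prod.swap])
        (auto simp: between_def intro: le_trans)
    also have "\<dots> = (\<Sum>d\<in>between a b. if a = d then s a b v else 0)"
    proof (intro sum.cong refl)
      fix d assume "d \<in> between a b"
      then have "le a d" by (simp add: between_def)
      then show "(\<Sum>c\<in>between a d. s a c (w c d (s d b v))) = (if a = d then s a b v else 0)"
        by (auto simp: right)
    qed
    also have "\<dots> = s a b v"
      using ab by (simp add: between_def le_refl finite_interval)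
    finally show "(\<Sum>c\<in>between a b. s a c (x c)) = 0" by simp
  qed (use \<open>le a b\<close> additive.zero[OF add] in auto)
  then show ?thesis by (simp add: x_def)
qed

text \<open>The equation \<open>s * w = \<delta>\<close> is solved for \<open>w a b\<close>, given
  the values \<open>w c b\<close> at the points \<open>c\<close> strictly above \<open>a\<close>;
  the recursion ends because the interval from \<open>c\<close> to \<open>b\<close> is smaller. It
  is meaningful when the diagonal maps \<open>s a a\<close> are bijective.\<close>

function right_inverse :: "('i \<Rightarrow> 'i \<Rightarrow> 'v::ab_group_add \<Rightarrow> 'v) \<Rightarrow> 'i \<Rightarrow> 'i \<Rightarrow> 'v \<Rightarrow> 'v" where
  "right_inverse s a b v = inv (s a a)
    ((if a = b then v else 0) - (\<Sum>c\<in>between a b - {a}. s a c (right_inverse s c b v)))"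
  by auto
termination
  by (relation "measure (\<lambda>(s, a, b, v). card (between a b))") (auto intro: card_between_less)

declare right_inverse.simps [simp del]

lemma right_inverse:
  assumes "\<And>a. bij (s a a)" "le a b"
  shows "(\<Sum>c\<in>between a b. s a c (right_inverse s c b v)) = (if a = b then v else 0)"
  unfolding sum_between_remove[OF assms(2)]
  by (subst right_inverse.simps) (simp add: surj_f_inv_f[OF bij_is_surj[OF assms(1)]])

text \<open>The failures of additivity and of homogeneity convolve with \<open>s\<close> to zero,
  hence vanish by \<open>convolution_eq_0D\<close>.\<close>

lemma linear_right_inverse:
  assumes bij: "\<And>a. bij (s a a)" and lin: "\<And>a b. Vector_Spaces.linear sc sc (s a b)"
    and ab: "le a b"
  shows "Vector_Spaces.linear sc sc (right_inverse s a b)"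
proof -
  interpret V: Vector_Spaces.linear sc sc "s c d" for c d by (rule lin)
  have inj: "v = 0" if "s a a v = 0" for a v
    using that injD[OF bij_is_inj[OF bij], of a v 0] by (simp add: V.zero)
  have "right_inverse s a b (v + w) - (right_inverse s a b v + right_inverse s a b w) = 0" for v w
    by (rule convolution_eq_0D[of s b
          "\<lambda>c. right_inverse s c b (v + w) - (right_inverse s c b v + right_inverse s c b w)"])
      (use inj ab in \<open>simp_all add: V.zero V.diff V.add sum_subtractf sum.distrib right_inverse[of s, OF bij]\<close>)
  moreover have "right_inverse s a b (sc k v) - sc k (right_inverse s a b v) = 0" for k v
    by (rule convolution_eq_0D[of s b
          "\<lambda>c. right_inverse s c b (sc k v) - sc k (right_inverse s c b v)"])
      (use inj ab in \<open>simp_all add: V.zero V.diff V.scale sum_subtractf right_inverse[of s, OF bij]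
        flip: V.vs1.scale_sum_right\<close>)
  ultimately show ?thesis
    by unfold_locales simp_all
qed

end

section \<open>Convolution inverses of maps on tensor products\<close>

lemma linear_sum_on:
  assumes "Vector_Spaces.linear s1 s2 f"
  shows "f (sum g A) = (\<Sum>x\<in>A. f (g x))"
proof -
  interpret Vector_Spaces.linear s1 s2 f by fact
  show ?thesis by (rule sum)
qed

lemma linear_tensor_right: "linear_map ((\<otimes>) v)"
  by unfold_locales (rule poly_mapping_eqI, clarsimp simp: lookup_add distrib_left mult.left_commute)+

lemma linear_tensor_left: "linear_map (\<lambda>v. v \<otimes> w)"
proof unfold_locales
  show "(v + v') \<otimes> w = v \<otimes> w + v' \<otimes> w" for v v' :: "'s \<Rightarrow>\<^sub>0 'k::field" and w :: "'t \<Rightarrow>\<^sub>0 'k"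
    by (rule poly_mapping_eqI) (clarsimp simp: lookup_add distrib_right)
  show "(c *\<^sub>K v) \<otimes> w = c *\<^sub>K (v \<otimes> w)" for c and v :: "'s \<Rightarrow>\<^sub>0 'k::field" and w :: "'t \<Rightarrow>\<^sub>0 'k"
    by (rule poly_mapping_eqI) clarsimp
qed

lemmas linear_lin_ext_scale = linear_lin_ext[OF free_vs.vector_space_axioms]
lemmas linear_lin_ext_mult = linear_lin_ext[OF field_vs.vector_space_axioms]
lemmas lin_ext_scale_basis = lin_ext_basis[OF free_vs.vector_space_axioms]
lemmas lin_ext_mult_basis = lin_ext_basis[OF field_vs.vector_space_axioms]

lemma linear_tensor_map: "linear_map (f \<otimes>\<^sub>m g)"
  unfolding tensor_map_def by (rule linear_lin_ext_scale)

lemma linear_tensor_map_form: "linear_map (f \<otimes>\<^sub>r \<phi>)"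
  unfolding tensor_map_form_def by (rule linear_lin_ext_scale)

lemma linear_tensor_form_map: "linear_map (\<phi> \<otimes>\<^sub>l g)"
  unfolding tensor_form_map_def by (rule linear_lin_ext_scale)

lemma linear_tensor_form: "linear_form (\<phi> \<otimes>\<^sub>f \<psi>)"
  unfolding tensor_form_def by (rule linear_lin_ext_mult)

lemma linear_tensor_assoc: "linear_map tensor_assoc"
  unfolding tensor_assoc_def by (rule linear_lin_ext_scale)

lemma linear_tensor_assoc': "linear_map tensor_assoc'"
  unfolding tensor_assoc'_def by (rule linear_lin_ext_scale)

lemma linear_tensor_interchange: "linear_map tensor_interchange"
  unfolding tensor_interchange_def by (rule linear_lin_ext_scale)

lemma linear_inc_comult: "linear_map inc_comult"
  unfolding inc_comult_def by (rule linear_lin_ext_scale)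

lemma linear_map_comp: "linear_map f \<Longrightarrow> linear_map g \<Longrightarrow> linear_map (g \<circ> f)"
  by (rule Vector_Spaces.linear_compose)

lemmas linear_intros =
  linear_tensor_map linear_tensor_map_form linear_tensor_form_map linear_tensor_assoc
  linear_tensor_assoc' linear_tensor_interchange linear_inc_comult linear_map_comp

lemma tensor_map_basis [simp]: "(f \<otimes>\<^sub>m g) (basis_vec (s, t)) = f (basis_vec s) \<otimes> g (basis_vec t)"
  by (simp add: tensor_map_def lin_ext_scale_basis)

lemma tensor_map_form_basis [simp]: "(f \<otimes>\<^sub>r \<phi>) (basis_vec (s, t)) = \<phi> (basis_vec t) *\<^sub>K f (basis_vec s)"
  by (simp add: tensor_map_form_def lin_ext_scale_basis)

lemma tensor_form_map_basis [simp]: "(\<phi> \<otimes>\<^sub>l g) (basis_vec (s, t)) = \<phi> (basis_vec s) *\<^sub>K g (basis_vec t)"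
  by (simp add: tensor_form_map_def lin_ext_scale_basis)

lemma tensor_form_basis [simp]: "(\<phi> \<otimes>\<^sub>f \<psi>) (basis_vec (s, t)) = \<phi> (basis_vec s) * \<psi> (basis_vec t)"
  by (simp add: tensor_form_def lin_ext_mult_basis)

lemma tensor_assoc_basis [simp]: "tensor_assoc (basis_vec ((s, t), u)) = basis_vec (s, (t, u))"
  by (simp add: tensor_assoc_def lin_ext_scale_basis)

lemma tensor_assoc'_basis [simp]: "tensor_assoc' (basis_vec (s, (t, u))) = basis_vec ((s, t), u)"
  by (simp add: tensor_assoc'_def lin_ext_scale_basis)

lemma tensor_interchange_basis [simp]: "tensor_interchange (basis_vec ((s, t), (u, v))) = basis_vec ((s, u), (t, v))"
  by (simp add: tensor_interchange_def lin_ext_scale_basis)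

lemma inc_comult_basis: "inc_comult (basis_vec p) =
    (\<Sum>c\<in>{lower p..upper p}. basis_vec (ivl (lower p) c, ivl c (upper p)))"
  by (simp add: inc_comult_def lin_ext_scale_basis)

lemma inc_counit_basis: "inc_counit (basis_vec p) = (if lower p = upper p then 1 else 0)"
  by (simp add: inc_counit_def lin_ext_mult_basis)

section \<open>Convolution inverses over the incidence coalgebra\<close>

lemma
  assumes "locally_finite TYPE('a::order)"
  shows locally_finite_order_le: "locally_finite_order ((\<le>) :: 'a \<Rightarrow> 'a \<Rightarrow> bool)"
    and locally_finite_order_ge: "locally_finite_order ((\<ge>) :: 'a \<Rightarrow> 'a \<Rightarrow> bool)"
proof -
  have "finite {c. a \<le> c \<and> c \<le> b}" for a b :: 'a
    using assms unfolding locally_finite_def atLeastAtMost_def atLeast_def atMost_def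
    by (simp flip: Collect_conj_eq)
  then show "locally_finite_order ((\<le>) :: 'a \<Rightarrow> 'a \<Rightarrow> bool)"
    "locally_finite_order ((\<ge>) :: 'a \<Rightarrow> 'a \<Rightarrow> bool)"
    by (unfold_locales; auto simp: conj_commute)+
qed

text \<open>Read as \<open>s a b = \<sigma> ((a, b) \<otimes> _)\<close>, the map lies in the
  incidence algebra with values in endomorphisms of \<open>KS\<close>, and both composites are
  convolution products there. Bijective diagonal values give a right inverse, which is then
  two-sided.\<close>

lemma left_convolution_inverse:
  fixes \<sigma> :: "('a::order intv \<times> 's \<Rightarrow>\<^sub>0 'k::field) \<Rightarrow> ('s \<Rightarrow>\<^sub>0 'k)"
  assumes lf: "locally_finite TYPE('a)" and \<sigma>: "linear_map \<sigma>"
    and bij: "\<And>a. bij (\<lambda>v. \<sigma> (basis_vec (ivl a a) \<otimes> v))"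
  obtains \<sigma>' where "linear_map \<sigma>'"
    "\<sigma>' \<circ> (id \<otimes>\<^sub>m \<sigma>) \<circ> tensor_assoc \<circ> (inc_comult \<otimes>\<^sub>m id) = inc_counit \<otimes>\<^sub>l id"
    "\<sigma> \<circ> (id \<otimes>\<^sub>m \<sigma>') \<circ> tensor_assoc \<circ> (inc_comult \<otimes>\<^sub>m id) = inc_counit \<otimes>\<^sub>l id"
proof -
  interpret locally_finite_order "(\<le>) :: 'a \<Rightarrow> 'a \<Rightarrow> bool"
    by (rule locally_finite_order_le[OF lf])
  define s where "s a b v = \<sigma> (basis_vec (ivl a b) \<otimes> v)" for a b v
  have bij: "bij (s a a)" for a
    using bij[of a] by (simp add: s_def[abs_def])
  have lin: "linear_map (s a b)" for a b
    unfolding s_def[abs_def] by (rule Vector_Spaces.linear_compose[OF linear_tensor_right \<sigma>, unfolded o_def])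
  define \<sigma>' where "\<sigma>' = lin_ext scale (\<lambda>(p, q). right_inverse s (lower p) (upper p) (basis_vec q))"
  have \<sigma>': "linear_map \<sigma>'"
    unfolding \<sigma>'_def by (rule linear_lin_ext_scale)
  \<comment> \<open>\<open>\<sigma>'\<close> is prescribed only on basis vectors; linearity of
    \<open>right_inverse\<close> carries the formula over to every \<open>v\<close>.\<close>
  have "(\<lambda>v. \<sigma>' (basis_vec p \<otimes> v)) = right_inverse s (lower p) (upper p)" for p
    by (rule linear_eq_on_basis[OF Vector_Spaces.linear_compose[OF linear_tensor_right \<sigma>', unfolded o_def]
          linear_right_inverse[of s, OF bij lin lower_le_upper]])
      (simp add: \<sigma>'_def lin_ext_scale_basis)
  then have \<sigma>'_eq: "\<sigma>' (basis_vec (ivl a b) \<otimes> v) = right_inverse s a b v" if "a \<le> b" for a b v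
    using that by (metis lower_ivl upper_ivl)
  \<comment> \<open>The comultiplication cuts \<open>p\<close> at each of its points
    \<open>c\<close>, which turns the composite into a convolution.\<close>
  have conv: "(f \<circ> (id \<otimes>\<^sub>m g) \<circ> tensor_assoc \<circ> (inc_comult \<otimes>\<^sub>m id)) (basis_vec (p, q)) =
      (\<Sum>c\<in>between (lower p) (upper p).
        f (basis_vec (ivl (lower p) c) \<otimes> g (basis_vec (ivl c (upper p)) \<otimes> basis_vec q)))"
    if f: "linear_map f" and g: "linear_map g" for f g :: "('a intv \<times> 's \<Rightarrow>\<^sub>0 'k) \<Rightarrow> ('s \<Rightarrow>\<^sub>0 'k)" and p q
    by (simp add: inc_comult_basis linear_sum_on[OF linear_tensor_left] linear_sum_on[OF f]
        linear_sum_on[OF linear_tensor_assoc] linear_sum_on[OF linear_tensor_map]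
        between_def atLeastAtMost_def atLeast_def atMost_def Collect_conj_eq)
  have unit: "(inc_counit \<otimes>\<^sub>l id) (basis_vec (p, q)) =
      (if lower p = upper p then basis_vec q else (0 :: 's \<Rightarrow>\<^sub>0 'k))" for p :: "'a intv" and q
    by (auto simp: inc_counit_basis intro!: poly_mapping_eqI)
  have mem: "c \<in> between a b \<longleftrightarrow> a \<le> c \<and> c \<le> b" for a b c :: 'a
    by (simp add: between_def)
  show thesis
  proof (rule that[OF \<sigma>'])
    interpret s: Vector_Spaces.linear scale scale "s c d" for c d by (rule lin)
    have inj: "v = 0" if "s a a v = 0" for a v
      using that injD[OF bij_is_inj[OF bij], of a v 0] by (simp add: s.zero)
    have left: "(\<Sum>c\<in>between (lower p) (upper p). right_inverse s (lower p) c (s c (upper p) v)) =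
        (if lower p = upper p then v else 0)" for p v
      by (rule left_inverse_if_right_inverse[of s, OF inj additive.intro right_inverse[of s, OF bij]])
        (auto intro: s.add lower_le_upper)
    show "\<sigma>' \<circ> (id \<otimes>\<^sub>m \<sigma>) \<circ> tensor_assoc \<circ> (inc_comult \<otimes>\<^sub>m id) = inc_counit \<otimes>\<^sub>l id"
    proof (intro linear_eq_on_basis[of scale] linear_intros \<sigma> \<sigma>')
      fix pq :: "'a intv \<times> 's"
      obtain p q where pq: "pq = (p, q)" by fastforce
      have "(\<Sum>c\<in>between (lower p) (upper p).
          \<sigma>' (basis_vec (ivl (lower p) c) \<otimes> \<sigma> (basis_vec (ivl c (upper p)) \<otimes> basis_vec q))) =
        (\<Sum>c\<in>between (lower p) (upper p). right_inverse s (lower p) c (s c (upper p) (basis_vec q)))"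
        by (intro sum.cong refl) (simp add: \<sigma>'_eq mem s_def del: tensor_basis)
      then show "(\<sigma>' \<circ> (id \<otimes>\<^sub>m \<sigma>) \<circ> tensor_assoc \<circ> (inc_comult \<otimes>\<^sub>m id)) (basis_vec pq) =
        (inc_counit \<otimes>\<^sub>l id) (basis_vec pq)"
        by (simp only: pq conv[OF \<sigma>' \<sigma>] unit left)
    qed
    show "\<sigma> \<circ> (id \<otimes>\<^sub>m \<sigma>') \<circ> tensor_assoc \<circ> (inc_comult \<otimes>\<^sub>m id) = inc_counit \<otimes>\<^sub>l id"
    proof (intro linear_eq_on_basis[of scale] linear_intros \<sigma> \<sigma>')
      fix pq :: "'a intv \<times> 's"
      obtain p q where pq: "pq = (p, q)" by fastforce
      have "(\<Sum>c\<in>between (lower p) (upper p).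
          \<sigma> (basis_vec (ivl (lower p) c) \<otimes> \<sigma>' (basis_vec (ivl c (upper p)) \<otimes> basis_vec q))) =
        (\<Sum>c\<in>between (lower p) (upper p). s (lower p) c (right_inverse s c (upper p) (basis_vec q)))"
        by (intro sum.cong refl) (simp add: \<sigma>'_eq mem s_def del: tensor_basis)
      then show "(\<sigma> \<circ> (id \<otimes>\<^sub>m \<sigma>') \<circ> tensor_assoc \<circ> (inc_comult \<otimes>\<^sub>m id)) (basis_vec pq) =
        (inc_counit \<otimes>\<^sub>l id) (basis_vec pq)"
        by (simp only: pq conv[OF \<sigma> \<sigma>'] unit right_inverse[of s, OF bij lower_le_upper])
    qed
  qed
qed
text \<open>The composition order is reversed here, which is why the order \<open>\<ge>\<close> is used.\<close>

lemma right_convolution_inverse: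
  fixes \<tau> :: "('s \<times> 'a::order intv \<Rightarrow>\<^sub>0 'k::field) \<Rightarrow> ('s \<Rightarrow>\<^sub>0 'k)"
  assumes lf: "locally_finite TYPE('a)" and \<tau>: "linear_map \<tau>"
    and bij: "\<And>a. bij (\<lambda>v. \<tau> (v \<otimes> basis_vec (ivl a a)))"
  obtains \<tau>' where "linear_map \<tau>'"
    "\<tau>' \<circ> (\<tau> \<otimes>\<^sub>m id) \<circ> tensor_assoc' \<circ> (id \<otimes>\<^sub>m inc_comult) = id \<otimes>\<^sub>r inc_counit"
    "\<tau> \<circ> (\<tau>' \<otimes>\<^sub>m id) \<circ> tensor_assoc' \<circ> (id \<otimes>\<^sub>m inc_comult) = id \<otimes>\<^sub>r inc_counit"
proof -
  interpret locally_finite_order "(\<ge>) :: 'a \<Rightarrow> 'a \<Rightarrow> bool"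
    by (rule locally_finite_order_ge[OF lf])
  \<comment> \<open>The endpoints are exchanged: \<open>s a b\<close> belongs to the interval from
    \<open>b\<close> to \<open>a\<close>, in accordance with the reversed order.\<close>
  define s where "s a b v = \<tau> (v \<otimes> basis_vec (ivl b a))" for a b v
  have bij: "bij (s a a)" for a
    using bij[of a] by (simp add: s_def[abs_def])
  have lin: "linear_map (s a b)" for a b
    unfolding s_def[abs_def] by (rule Vector_Spaces.linear_compose[OF linear_tensor_left \<tau>, unfolded o_def])
  define \<tau>' where "\<tau>' = lin_ext scale (\<lambda>(q, p). right_inverse s (upper p) (lower p) (basis_vec q))"
  have \<tau>': "linear_map \<tau>'"
    unfolding \<tau>'_def by (rule linear_lin_ext_scale)
  have "(\<lambda>v. \<tau>' (v \<otimes> basis_vec p)) = right_inverse s (upper p) (lower p)" for p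
    by (rule linear_eq_on_basis[OF Vector_Spaces.linear_compose[OF linear_tensor_left \<tau>', unfolded o_def]
          linear_right_inverse[of s, OF bij lin lower_le_upper]])
      (simp add: \<tau>'_def lin_ext_scale_basis)
  then have \<tau>'_eq: "\<tau>' (v \<otimes> basis_vec (ivl b a)) = right_inverse s a b v" if "b \<le> a" for a b v
    using that by (metis lower_ivl upper_ivl)
  have conv: "(f \<circ> (g \<otimes>\<^sub>m id) \<circ> tensor_assoc' \<circ> (id \<otimes>\<^sub>m inc_comult)) (basis_vec (q, p)) =
      (\<Sum>c\<in>between (upper p) (lower p).
        f (g (basis_vec q \<otimes> basis_vec (ivl (lower p) c)) \<otimes> basis_vec (ivl c (upper p))))"
    if f: "linear_map f" and g: "linear_map g" for f g :: "('s \<times> 'a intv \<Rightarrow>\<^sub>0 'k) \<Rightarrow> ('s \<Rightarrow>\<^sub>0 'k)" and p q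
    by (simp add: inc_comult_basis linear_sum_on[OF linear_tensor_right] linear_sum_on[OF f]
        linear_sum_on[OF linear_tensor_assoc'] linear_sum_on[OF linear_tensor_map]
        between_def atLeastAtMost_def atLeast_def atMost_def Collect_conj_eq Int_commute)
  have unit: "(id \<otimes>\<^sub>r inc_counit) (basis_vec (q, p)) =
      (if upper p = lower p then basis_vec q else (0 :: 's \<Rightarrow>\<^sub>0 'k))" for p :: "'a intv" and q
    by (auto simp: inc_counit_basis intro!: poly_mapping_eqI)
  have mem: "c \<in> between a b \<longleftrightarrow> b \<le> c \<and> c \<le> a" for a b c :: 'a
    by (auto simp: between_def)
  show thesis
  proof (rule that[OF \<tau>'])
    interpret s: Vector_Spaces.linear scale scale "s c d" for c d by (rule lin)
    have inj: "v = 0" if "s a a v = 0" for a v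
      using that injD[OF bij_is_inj[OF bij], of a v 0] by (simp add: s.zero)
    have left: "(\<Sum>c\<in>between (upper p) (lower p). right_inverse s (upper p) c (s c (lower p) v)) =
        (if upper p = lower p then v else 0)" for p v
      by (rule left_inverse_if_right_inverse[of s, OF inj additive.intro right_inverse[of s, OF bij]])
        (auto intro: s.add lower_le_upper)
    show "\<tau>' \<circ> (\<tau> \<otimes>\<^sub>m id) \<circ> tensor_assoc' \<circ> (id \<otimes>\<^sub>m inc_comult) = id \<otimes>\<^sub>r inc_counit"
    proof (intro linear_eq_on_basis[of scale] linear_intros \<tau> \<tau>')
      fix qp :: "'s \<times> 'a intv"
      obtain p q where qp: "qp = (q, p)" by fastforce
      have "(\<Sum>c\<in>between (upper p) (lower p).
          \<tau>' (\<tau> (basis_vec q \<otimes> basis_vec (ivl (lower p) c)) \<otimes> basis_vec (ivl c (upper p)))) =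
        (\<Sum>c\<in>between (upper p) (lower p). right_inverse s (upper p) c (s c (lower p) (basis_vec q)))"
        by (intro sum.cong refl) (simp add: \<tau>'_eq mem s_def del: tensor_basis)
      then show "(\<tau>' \<circ> (\<tau> \<otimes>\<^sub>m id) \<circ> tensor_assoc' \<circ> (id \<otimes>\<^sub>m inc_comult)) (basis_vec qp) =
        (id \<otimes>\<^sub>r inc_counit) (basis_vec qp)"
        by (simp only: qp conv[OF \<tau>' \<tau>] unit left)
    qed
    show "\<tau> \<circ> (\<tau>' \<otimes>\<^sub>m id) \<circ> tensor_assoc' \<circ> (id \<otimes>\<^sub>m inc_comult) = id \<otimes>\<^sub>r inc_counit"
    proof (intro linear_eq_on_basis[of scale] linear_intros \<tau> \<tau>')
      fix qp :: "'s \<times> 'a intv"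
      obtain p q where qp: "qp = (q, p)" by fastforce
      have "(\<Sum>c\<in>between (upper p) (lower p).
          \<tau> (\<tau>' (basis_vec q \<otimes> basis_vec (ivl (lower p) c)) \<otimes> basis_vec (ivl c (upper p)))) =
        (\<Sum>c\<in>between (upper p) (lower p). s (upper p) c (right_inverse s c (lower p) (basis_vec q)))"
        by (intro sum.cong refl) (simp add: \<tau>'_eq mem s_def del: tensor_basis)
      then show "(\<tau> \<circ> (\<tau>' \<otimes>\<^sub>m id) \<circ> tensor_assoc' \<circ> (id \<otimes>\<^sub>m inc_comult)) (basis_vec qp) =
        (id \<otimes>\<^sub>r inc_counit) (basis_vec qp)"
        by (simp only: qp conv[OF \<tau> \<tau>'] unit right_inverse[of s, OF bij lower_le_upper])
    qed
  qed
qed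

section \<open>Intervals, counits and the comultiplication of the tensor square\<close>

lemma intv_eqI: "lower p = lower q \<Longrightarrow> upper p = upper q \<Longrightarrow> p = q"
  by (metis ivl_lower_upper)

lemma card_subinterval_le:
  assumes "locally_finite TYPE('a::order)"
    and "lower (q :: 'a intv) \<le> lower p" "upper p \<le> upper q"
  shows "card {lower p..upper p} \<le> card {lower q..upper q}"
  using assms by (intro card_mono) (auto simp: locally_finite_def)

text \<open>The number of points of an interval is the measure in all later uses of
  \<open>triangular_bij\<close>. An interval is determined by its endpoints, so a proper subinterval
  misses a point.\<close>

lemma card_subinterval_less:
  assumes "locally_finite TYPE('a::order)"
    and "lower (q :: 'a intv) \<le> lower p" "upper p \<le> upper q" "p \<noteq> q"
  shows "card {lower p..upper p} < card {lower q..upper q}"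
proof (rule psubset_card_mono)
  show "finite {lower q..upper q}"
    using assms(1) by (simp add: locally_finite_def)
  have "lower p \<noteq> lower q \<or> upper p \<noteq> upper q"
    using assms(4) intv_eqI by blast
  then show "{lower p..upper p} \<subset> {lower q..upper q}"
    using assms(2,3) lower_le_upper[of p] lower_le_upper[of q]
    by (auto simp: psubset_eq atLeastatMost_subset_iff Icc_eq_Icc)
qed

text \<open>The inverse applies \<open>inv f\<close> to the endpoints; since both maps preserve the
  order, every \<open>ivl\<close> that occurs is a genuine interval.\<close>

lemma bij_map_intv:
  assumes "order_automorphism f"
  shows "bij (\<lambda>p. ivl (f (lower p)) (f (upper p)))"
proof (rule o_bij)
  let ?g = "inv f"
  have f: "f x \<le> f y \<longleftrightarrow> x \<le> y" "f (?g x) = x" "?g (f x) = x" for x y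
    using assms by (auto simp: order_automorphism_def surj_f_inv_f[OF bij_is_surj] inv_f_f[OF bij_is_inj])
  then have g: "?g x \<le> ?g y \<longleftrightarrow> x \<le> y" for x y by metis
  show "(\<lambda>p. ivl (?g (lower p)) (?g (upper p))) \<circ> (\<lambda>p. ivl (f (lower p)) (f (upper p))) = id"
    "(\<lambda>p. ivl (f (lower p)) (f (upper p))) \<circ> (\<lambda>p. ivl (?g (lower p)) (?g (upper p))) = id"
    by (auto simp: f g lower_le_upper)
qed

text \<open>The only second component in the support of \<open>w\<close> is the degenerate interval
  \<open>t0\<close>, where the counit is 1. Hence the counit merely drops this component, without
  summation.\<close>

lemma lookup_tensor_map_form_counit:
  assumes "\<And>s t. lookup w (s, t) \<noteq> 0 \<Longrightarrow> t = t0" "lower t0 = upper t0"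
  shows "lookup ((id \<otimes>\<^sub>r inc_counit) w) s = lookup w (s, t0)"
proof -
  have "lookup ((id \<otimes>\<^sub>r inc_counit) w) s =
      (\<Sum>k\<in>keys w. lookup w k * lookup ((id \<otimes>\<^sub>r inc_counit) (basis_vec k)) s)"
    by (rule lookup_linear[OF linear_tensor_map_form]) auto
  also have "\<dots> = (\<Sum>k\<in>keys w. if k = (s, t0) then lookup w (s, t0) else 0)"
  proof (rule sum.cong[OF refl])
    fix k assume "k \<in> keys w"
    then obtain s' where "k = (s', t0)"
      using assms(1) by (cases k) (auto simp: in_keys_iff)
    then show "lookup w k * lookup ((id \<otimes>\<^sub>r inc_counit) (basis_vec k)) s =
        (if k = (s, t0) then lookup w (s, t0) else 0)"
      using assms(2) by (simp add: inc_counit_basis lookup_single when_def)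
  qed
  also have "\<dots> = lookup w (s, t0)"
    by (simp add: in_keys_iff)
  finally show ?thesis .
qed

lemma lookup_tensor_form_map_counit:
  assumes "\<And>s t. lookup w (s, t) \<noteq> 0 \<Longrightarrow> s = s0" "lower s0 = upper s0"
  shows "lookup ((inc_counit \<otimes>\<^sub>l id) w) t = lookup w (s0, t)"
proof -
  have "lookup ((inc_counit \<otimes>\<^sub>l id) w) t =
      (\<Sum>k\<in>keys w. lookup w k * lookup ((inc_counit \<otimes>\<^sub>l id) (basis_vec k)) t)"
    by (rule lookup_linear[OF linear_tensor_form_map]) auto
  also have "\<dots> = (\<Sum>k\<in>keys w. if k = (s0, t) then lookup w (s0, t) else 0)"
  proof (rule sum.cong[OF refl])
    fix k assume "k \<in> keys w"
    then obtain t' where "k = (s0, t')"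
      using assms(1) by (cases k) (auto simp: in_keys_iff)
    then show "lookup w k * lookup ((inc_counit \<otimes>\<^sub>l id) (basis_vec k)) t =
        (if k = (s0, t) then lookup w (s0, t) else 0)"
      using assms(2) by (simp add: inc_counit_basis lookup_single when_def)
  qed
  also have "\<dots> = lookup w (s0, t)"
    by (simp add: in_keys_iff)
  finally show ?thesis .
qed

section \<open>Coefficients of the comultiplication of the tensor square\<close>

lemma tensor_comult_basis:
  "tensor_comult inc_comult inc_comult (basis_vec (p, q)) =
    (\<Sum>(u, v)\<in>{lower p..upper p} \<times> {lower q..upper q}.
      basis_vec ((ivl (lower p) u, ivl (lower q) v), (ivl u (upper p), ivl v (upper q))))"
proof -
  have "tensor_comult inc_comult inc_comult (basis_vec (p, q)) =
      (\<Sum>u\<in>{lower p..upper p}. \<Sum>v\<in>{lower q..upper q}.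
        basis_vec ((ivl (lower p) u, ivl (lower q) v), (ivl u (upper p), ivl v (upper q))))"
    by (simp add: tensor_comult_def inc_comult_basis linear_sum_on[OF linear_tensor_left]
        linear_sum_on[OF linear_tensor_right] linear_sum_on[OF linear_tensor_interchange])
      (rule sum.swap)
  then show ?thesis
    by (simp only: sum.cartesian_product)
qed

lemma linear_tensor_comult: "linear_map (tensor_comult inc_comult inc_comult)"
  unfolding tensor_comult_def by (intro linear_intros)

text \<open>The target pair determines the cut points, \<open>u = upper s1\<close> and
  \<open>v = upper t1\<close>, so at most one summand contributes.\<close>

lemma lookup_tensor_comult_basis:
  fixes p q s1 s2 t1 t2 :: "'a::order intv"
  assumes "locally_finite TYPE('a)"
  shows "lookup (tensor_comult inc_comult inc_comult (basis_vec (p, q))) ((s1, t1), (s2, t2)) =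
    (if upper s1 = lower s2 \<and> upper t1 = lower t2 \<and>
        (p, q) = (ivl (lower s1) (upper s2), ivl (lower t1) (upper t2)) then 1 else 0)"
    (is "_ = (if ?C then _ else _)")
proof -
  have fin: "finite ({lower p..upper p} \<times> {lower q..upper q})"
    using assms by (simp add: locally_finite_def)
  have eq: "((ivl (lower p) u, ivl (lower q) v), (ivl u (upper p), ivl v (upper q))) = ((s1, t1), (s2, t2))
      \<longleftrightarrow> (u, v) = (upper s1, upper t1) \<and> ?C"
    if "(u, v) \<in> {lower p..upper p} \<times> {lower q..upper q}" for u v
    using that lower_le_upper[of s1] lower_le_upper[of s2] lower_le_upper[of t1] lower_le_upper[of t2]
      order_trans[of "lower s1" "upper s1" "upper s2"] order_trans[of "lower t1" "upper t1" "upper t2"]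
    by (auto intro!: intv_eqI)
  have "lookup (tensor_comult inc_comult inc_comult (basis_vec (p, q))) ((s1, t1), (s2, t2)) =
      (\<Sum>x\<in>{lower p..upper p} \<times> {lower q..upper q}.
        if x = (upper s1, upper t1) then (if ?C then 1 else 0) else 0)"
    unfolding tensor_comult_basis lookup_sum
  proof (intro sum.cong refl, clarify)
    fix u v assume "u \<in> {lower p..upper p}" "v \<in> {lower q..upper q}"
    with eq[of u v] show "lookup (basis_vec ((ivl (lower p) u, ivl (lower q) v), (ivl u (upper p), ivl v (upper q))))
        ((s1, t1), (s2, t2)) = (if (u, v) = (upper s1, upper t1) then (if ?C then 1 else 0) else 0)"
      by (simp add: lookup_single when_def del: prod.inject)
  qed
  also have "\<dots> = (if ?C then 1 else 0)"
    using fin lower_le_upper[of s1] lower_le_upper[of s2] lower_le_upper[of t1] lower_le_upper[of t2]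
      order_trans[of "lower s1" "upper s1" "upper s2"] order_trans[of "lower t1" "upper t1" "upper t2"]
    by auto
  finally show ?thesis .
qed

text \<open>Adjacent intervals arise only by cutting their union, so a single key of
  \<open>w\<close> is relevant.\<close>

lemma lookup_tensor_comult:
  fixes s1 s2 t1 t2 :: "'a::order intv"
  assumes "locally_finite TYPE('a)"
  shows "lookup (tensor_comult inc_comult inc_comult w) ((s1, t1), (s2, t2)) =
    (if upper s1 = lower s2 \<and> upper t1 = lower t2
     then lookup w (ivl (lower s1) (upper s2), ivl (lower t1) (upper t2)) else 0)"
    (is "_ = (if ?C then lookup w ?k else 0)")
proof -
  have "lookup (tensor_comult inc_comult inc_comult w) ((s1, t1), (s2, t2)) =
      (\<Sum>k\<in>keys w. lookup w k *
        lookup (tensor_comult inc_comult inc_comult (basis_vec k)) ((s1, t1), (s2, t2)))"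
    by (rule lookup_linear[OF linear_tensor_comult]) auto
  also have "\<dots> = (\<Sum>k\<in>keys w. if k = ?k then (if ?C then lookup w ?k else 0) else 0)"
  proof (intro sum.cong refl)
    fix k :: "'a intv \<times> 'a intv"
    show "lookup w k * lookup (tensor_comult inc_comult inc_comult (basis_vec k)) ((s1, t1), (s2, t2)) =
        (if k = ?k then (if ?C then lookup w ?k else 0) else 0)"
      by (cases k) (simp only: lookup_tensor_comult_basis[OF assms], auto)
  qed
  also have "\<dots> = (if ?C then lookup w ?k else 0)"
    by (simp add: in_keys_iff)
  finally show ?thesis .
qed

section \<open>Endomorphisms satisfying (0)--(5)\<close>

text \<open>The hypotheses of the theorem are collected here for the lemmas below. \<open>L\<close>,
  \<open>R\<close> and \<open>lam\<close> are parameters with defining equations, which keeps them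
  folded during simplification.\<close>

locale restricted_endomorphism =
  fixes r :: "('a::order intv \<times> 'a intv \<Rightarrow>\<^sub>0 'k::field) \<Rightarrow> ('a intv \<times> 'a intv \<Rightarrow>\<^sub>0 'k)"
    and r0 :: "'a \<times> 'a \<Rightarrow> 'a \<times> 'a"
    and L R :: "'a \<Rightarrow> 'a \<Rightarrow> 'a"
    and lam :: "'a \<Rightarrow> 'a \<Rightarrow> 'a \<Rightarrow> 'a \<Rightarrow> 'a \<Rightarrow> 'a \<Rightarrow> 'a \<Rightarrow> 'a \<Rightarrow> 'k"
  assumes L_eq: "L = left_map r0" and R_eq: "R = right_map r0" and lam_eq: "lam = coefficient r"
    and lf: "locally_finite TYPE('a)"
    and lin: "linear_map r"
    and restr: "induces_by_restriction r r0"
    and nondeg: "nondegenerate_bij r0"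
    and cond0: "\<And>a b c d. a \<le> b \<Longrightarrow> c \<le> d \<Longrightarrow>
      (\<Sum>(e, g). lam a b c d e e g g) = (if a = b then 1 else 0) * (if c = d then 1 else 0)"
    and cond1: "\<And>a b. order_automorphism (L a) \<and> order_automorphism (R b)"
    and cond2: "\<And>a b. same_component a b \<Longrightarrow> L a = L b \<and> R a = R b"
    and cond3: "\<And>a b c d e f g h.
      a \<le> b \<Longrightarrow> c \<le> d \<Longrightarrow> e \<le> f \<Longrightarrow> g \<le> h \<Longrightarrow> lam a b c d e f g h \<noteq> 0 \<Longrightarrow>
      R c a \<le> g \<and> g \<le> h \<and> h \<le> R c b \<and> L a c \<le> e \<and> e \<le> f \<and> f \<le> L a d"
    and cond4: "\<And>a b c d e f g h y z.
      a \<le> b \<Longrightarrow> c \<le> d \<Longrightarrow> e \<le> f \<Longrightarrow> g \<le> h \<Longrightarrow>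
      R c a \<le> g \<Longrightarrow> h \<le> R c b \<Longrightarrow> L a c \<le> e \<Longrightarrow> f \<le> L a d \<Longrightarrow>
      e \<le> y \<Longrightarrow> y \<le> f \<Longrightarrow> g \<le> z \<Longrightarrow> z \<le> h \<Longrightarrow>
      lam a b c d e f g h =
        lam a (inv (R c) z) c (inv (L a) y) e y g z *
        lam (inv (R c) z) b (inv (L a) y) d y f z h"
    and cond5: "\<And>a b c d. a \<le> b \<Longrightarrow> c \<le> d \<Longrightarrow>
      lam a b c d (L a c) (L a d) (R c a) (R c b) \<noteq> 0"
begin

lemma L_le_iff [simp]: "L a x \<le> L a y \<longleftrightarrow> x \<le> y"
  and R_le_iff [simp]: "R a x \<le> R a y \<longleftrightarrow> x \<le> y"
  using cond1 by (auto simp: order_automorphism_def)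

lemma L_eq_iff [simp]: "L a x = L a y \<longleftrightarrow> x = y"
  and R_eq_iff [simp]: "R a x = R a y \<longleftrightarrow> x = y"
  by (metis L_le_iff order.antisym order_refl) (metis R_le_iff order.antisym order_refl)

lemma L_inv [simp]: "L a (inv (L a) x) = x"
  and R_inv [simp]: "R a (inv (R a) x) = x"
  using cond1[of a a] by (auto simp: order_automorphism_def surj_f_inv_f[OF bij_is_surj])

lemma inv_L [simp]: "inv (L a) (L a x) = x"
  and inv_R [simp]: "inv (R a) (R a x) = x"
  by (metis L_inv L_eq_iff) (metis R_inv R_eq_iff)

text \<open>Comparable elements lie in one component. Along an interval the index of
  \<open>L\<close> or \<open>R\<close> may therefore be moved to any of its points.\<close>

lemma L_comparable: "a \<le> b \<Longrightarrow> L b = L a"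
  and R_comparable: "a \<le> b \<Longrightarrow> R b = R a"
  using cond2[of a b] by (auto simp: same_component_def r_into_equivclp)

lemma r0_apply: "r0 (a, c) = (L a c, R c a)"
  by (simp add: L_eq R_eq left_map_def right_map_def)

lemma r0_eqD: "L a c = L a' c' \<Longrightarrow> R c a = R c' a' \<Longrightarrow> a = a' \<and> c = c'"
  using nondeg bij_is_inj[of r0] r0_apply[of a c] r0_apply[of a' c']
  by (metis nondegenerate_bij_def injD prod.inject)

lemma lookup_r:
  "lookup (r (basis_vec (p, q))) (s, t) =
    lam (lower p) (upper p) (lower q) (upper q) (lower s) (upper s) (lower t) (upper t)"
  by (simp add: lam_eq coefficient_def lower_le_upper)

lemma lam_group_like: "lam a a c c (L a c) (L a c) (R c a) (R c a) = 1"
  using restr by (simp add: induces_by_restriction_def r0_apply lam_eq coefficient_def)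

text \<open>Condition (4) with the cut points written as \<open>y = L a q\<close> and
  \<open>z = R c p\<close>, which removes the inverse maps.\<close>

lemma lam_split:
  assumes "a \<le> b" "c \<le> d" "R c a \<le> g" "g \<le> R c p" "R c p \<le> h" "h \<le> R c b"
    "L a c \<le> e" "e \<le> L a q" "L a q \<le> f" "f \<le> L a d"
  shows "lam a b c d e f g h = lam a p c q e (L a q) g (R c p) * lam p b q d (L a q) f (R c p) h"
  using cond4[of a b c d e f g h "L a q" "R c p"] assms by auto

section \<open>The two mutually inverse functions in the incidence algebra of
  \<open>X \<times> X\<close>\<close>

definition top_coeff :: "'a \<times> 'a \<Rightarrow> 'a \<times> 'a \<Rightarrow> 'k"
  where "top_coeff = (\<lambda>(a, c) (b, d). lam a b c d (L a d) (L a d) (R c b) (R c b))"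

text \<open>This is \<beta> of the overview, and \<open>top_coeff\<close> is \<alpha>: the
  degenerate intervals sit at the smallest, respectively largest, points that (3) permits.\<close>

definition bottom_coeff :: "'a \<times> 'a \<Rightarrow> 'a \<times> 'a \<Rightarrow> 'k"
  where "bottom_coeff = (\<lambda>(a, c) (b, d). lam a b c d (L a c) (L a c) (R c a) (R c a))"

definition le2 :: "'a \<times> 'a \<Rightarrow> 'a \<times> 'a \<Rightarrow> bool"
  where "le2 = (\<lambda>(a, c) (b, d). a \<le> b \<and> c \<le> d)"

lemma finite_interval [simp]: "finite {a..b :: 'a}"
  using lf by (simp add: locally_finite_def)

lemma interval2: "{z. le2 (a, c) z \<and> le2 z (b, d)} = {a..b} \<times> {c..d}"
  by (auto simp: le2_def)

sublocale square: locally_finite_order le2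
proof
  show "finite {z. le2 x z \<and> le2 z y}" for x y
    by (cases x; cases y) (simp add: interval2)
qed (auto simp: le2_def)

lemma between2 [simp]: "square.between (a, c) (b, d) = {a..b} \<times> {c..d}"
  by (simp add: square.between_def interval2)

text \<open>By (3), the nonzero terms in (0) have the form \<open>e = L a q\<close>,
  \<open>g = R c p\<close> with \<open>p\<close> in \<open>{a..b}\<close> and \<open>q\<close> in
  \<open>{c..d}\<close>. Cutting there splits each term into a factor from \<open>top_coeff\<close>
  and one from \<open>bottom_coeff\<close>.\<close>

lemma top_mult_bottom:
  assumes "le2 x y"
  shows "(\<Sum>z\<in>square.between x y. top_coeff x z * bottom_coeff z y) = (if x = y then 1 else 0)"
proof -
  obtain a c b d where xy: "x = (a, c)" "y = (b, d)" by fastforce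
  with assms have le: "a \<le> b" "c \<le> d" by (auto simp: le2_def)
  let ?I = "{a..b} \<times> {c..d}" and ?h = "\<lambda>(p, q). (L a q, R c p)"
  let ?g = "\<lambda>(e, g). lam a b c d e e g g"
  have "z \<in> ?h ` ?I" if "?g z \<noteq> 0" for z
  proof -
    obtain e g where z: "z = (e, g)" by fastforce
    with that have "lam a b c d e e g g \<noteq> 0" by simp
    from cond3[OF le _ _ this]
    have "R c a \<le> R c (inv (R c) g)" "R c (inv (R c) g) \<le> R c b"
      "L a c \<le> L a (inv (L a) e)" "L a (inv (L a) e) \<le> L a d"
      by simp_all
    then have "(inv (R c) g, inv (L a) e) \<in> ?I"
      by (simp only: L_le_iff R_le_iff) simp
    then show ?thesis
      by (rule rev_image_eqI) (simp add: z)
  qed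
  \<comment> \<open>The sum in (0) over all pairs is a \<open>Sum_any\<close>, with value 0 for
    infinite support by default; here the support lies in a finite box.\<close>
  then have "Sum_any ?g = sum ?g (?h ` ?I)"
    by (intro Sum_any.expand_superset) auto
  also have "\<dots> = (\<Sum>(p, q)\<in>?I. lam a b c d (L a q) (L a q) (R c p) (R c p))"
    by (subst sum.reindex) (auto simp: inj_on_def case_prod_unfold o_def)
  also have "\<dots> = (\<Sum>z\<in>?I. top_coeff x z * bottom_coeff z y)"
  proof (intro sum.cong refl, clarify)
    fix p q assume "p \<in> {a..b}" "q \<in> {c..d}"
    then have "lam a b c d (L a q) (L a q) (R c p) (R c p) =
        lam a p c q (L a q) (L a q) (R c p) (R c p) * lam p b q d (L a q) (L a q) (R c p) (R c p)"
      using le by (intro lam_split) auto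
    with \<open>p \<in> {a..b}\<close> \<open>q \<in> {c..d}\<close>
    show "lam a b c d (L a q) (L a q) (R c p) (R c p) = top_coeff x (p, q) * bottom_coeff (p, q) y"
      by (simp add: top_coeff_def bottom_coeff_def xy L_comparable[of a p] R_comparable[of c q])
  qed
  finally have "(\<Sum>z\<in>?I. top_coeff x z * bottom_coeff z y) = Sum_any ?g"
    by (rule sym)
  also note cond0[OF le]
  finally show ?thesis
    by (simp only: xy between2) auto
qed

text \<open>A right inverse is also a left inverse, applied to scalars acting on \<open>'k\<close>
  by multiplication. The diagonal of \<open>top_coeff\<close> is 1 by
  \<open>lam_group_like\<close>.\<close>

lemma bottom_mult_top:
  assumes "le2 x y"
  shows "(\<Sum>z\<in>square.between x y. bottom_coeff x z * top_coeff z y) = (if x = y then 1 else 0)"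
proof -
  \<comment> \<open>The factor 1 is the argument at which the multiplication operators are
    evaluated.\<close>
  have "(\<Sum>z\<in>square.between x y. bottom_coeff x z * (top_coeff z y * 1)) = (if x = y then 1 else 0)"
  proof (rule square.left_inverse_if_right_inverse[of "\<lambda>x y v. top_coeff x y * v"])
    show "v = 0" if "top_coeff x x * v = 0" for x v
      using that by (cases x) (simp add: top_coeff_def lam_group_like)
    show "additive (\<lambda>v. top_coeff x y * v)" for x y
      by (simp add: additive_def distrib_left)
    show "(\<Sum>z\<in>square.between x y. top_coeff x z * (bottom_coeff z y * v)) = (if x = y then v else 0)"
      if "le2 x y" for x y v
    proof -
      have "(\<Sum>z\<in>square.between x y. top_coeff x z * (bottom_coeff z y * v)) =
          (\<Sum>z\<in>square.between x y. top_coeff x z * bottom_coeff z y) * v"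
        by (simp add: sum_distrib_right)
      then show ?thesis by (simp add: top_mult_bottom[OF that])
    qed
  qed fact
  then show ?thesis by simp
qed

text \<open>The left side is a coefficient of \<open>(r \<otimes> r) \<circ> \<Delta>\<close>, the
  right side that of \<open>\<Delta> \<circ> r\<close>. After the factors \<open>?A\<close> and
  \<open>?B\<close> common to all summands are split off, the sum becomes \<beta> *
  \<alpha>.\<close>

lemma lam_convolution:
  assumes le: "a \<le> b" "c \<le> d" "e \<le> y" "g \<le> z" "y' \<le> f" "z' \<le> h"
  shows "(\<Sum>(p, q)\<in>{a..b} \<times> {c..d}. lam a p c q e y g z * lam p b q d y' f z' h) =
    (if y = y' \<and> z = z' then lam a b c d e f g h else 0)"
proof (cases "L a c \<le> e \<and> R c a \<le> g \<and> f \<le> L a d \<and> h \<le> R c b")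
  case False
  \<comment> \<open>If a product were nonzero, (3) for its two factors, with indices moved by (2),
    would yield exactly the bounds that fail.\<close>
  have "lam a p c q e y g z * lam p b q d y' f z' h = 0" if "p \<in> {a..b}" "q \<in> {c..d}" for p q
  proof (rule ccontr)
    assume "\<not> ?thesis"
    with that le cond3[of a p c q e y g z] cond3[of p b q d y' f z' h] L_comparable[of a p] R_comparable[of c q]
      False show False
      by auto
  qed
  then have "(\<Sum>(p, q)\<in>{a..b} \<times> {c..d}. lam a p c q e y g z * lam p b q d y' f z' h) = 0"
    by (intro sum.neutral) auto
  moreover have "lam a b c d e f g h = 0" if "y = y'" "z = z'"
    using False that cond3[of a b c d e f g h] le by force
  ultimately show ?thesis by auto
next
  case True
  \<comment> \<open>The target points \<open>y\<close>, \<open>z\<close>, \<open>y'\<close>,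
    \<open>z'\<close> are pulled back to the source. The tensor factors cross over: \<open>z\<close>
    gives a point for \<open>{a..b}\<close> and \<open>y\<close> one for
    \<open>{c..d}\<close>.\<close>
  define P where "P = inv (R c) z"
  define Q where "Q = inv (L a) y"
  define P' where "P' = inv (R c) z'"
  define Q' where "Q' = inv (L a) y'"
  have y: "y = L a Q" "y' = L a Q'" and z: "z = R c P" "z' = R c P'"
    by (simp_all add: P_def Q_def P'_def Q'_def)
  have "L a c \<le> L a Q" "R c a \<le> R c P" "L a Q' \<le> L a d" "R c P' \<le> R c b"
    using True le y z by (metis order_trans)+
  then have PQ: "c \<le> Q" "a \<le> P" "Q' \<le> d" "P' \<le> b" by simp_all
  let ?A = "lam a P c Q e y g z" and ?B = "lam P' b Q' d y' f z' h"
  let ?t = "\<lambda>(p, q). lam a p c q e y g z * lam p b q d y' f z' h"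
  \<comment> \<open>Condition (3) for the first factor bounds \<open>p\<close> and \<open>q\<close>
    below by \<open>P\<close> and \<open>Q\<close>; for the second factor it bounds them above by
    \<open>P'\<close> and \<open>Q'\<close>.\<close>
  have zero: "P \<le> p \<and> p \<le> P' \<and> Q \<le> q \<and> q \<le> Q'"
    if "p \<in> {a..b}" "q \<in> {c..d}" "?t (p, q) \<noteq> 0" for p q
  proof -
    have "z \<le> R c p" "y \<le> L a q" "R q p \<le> z'" "L p q \<le> y'"
      using cond3[of a p c q e y g z] cond3[of p b q d y' f z' h] that le by auto
    then show ?thesis
      using that L_comparable[of a p] R_comparable[of c q] by (simp add: y z)
  qed
  have "sum ?t ({a..b} \<times> {c..d}) = sum ?t ({P..P'} \<times> {Q..Q'})"
  proof (rule sum.mono_neutral_right)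
    show "{P..P'} \<times> {Q..Q'} \<subseteq> {a..b} \<times> {c..d}"
      using PQ by (auto intro: order_trans)
    show "\<forall>w\<in>{a..b} \<times> {c..d} - {P..P'} \<times> {Q..Q'}. ?t w = 0"
    proof
      fix w assume w: "w \<in> {a..b} \<times> {c..d} - {P..P'} \<times> {Q..Q'}"
      then show "?t w = 0"
        using zero[of "fst w" "snd w"] by (cases w) auto
    qed
  qed simp
  also have "\<dots> = (\<Sum>w\<in>{P..P'} \<times> {Q..Q'}. ?A * ?B * (bottom_coeff (P, Q) w * top_coeff w (P', Q')))"
  proof (intro sum.cong refl, clarify)
    fix p q assume pq: "p \<in> {P..P'}" "q \<in> {Q..Q'}"
    then have cmp: "L p = L a" "L P = L a" "R q = R c" "R Q = R c"
      using PQ by (auto intro!: L_comparable R_comparable intro: order_trans)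
    \<comment> \<open>Cutting at the upper ends \<open>y\<close>, \<open>z\<close> leaves a second
      factor with degenerate targets at \<open>L P Q\<close> and \<open>R Q P\<close>, a value of
      \<open>bottom_coeff\<close>. Cutting the other coefficient at its lower ends
      \<open>y'\<close>, \<open>z'\<close> leaves a value of \<open>top_coeff\<close> in the same
      way.\<close>
    have "lam a p c q e y g z = ?A * lam P p Q q y y z z"
      using pq PQ True le unfolding y z by (intro lam_split) (auto intro: order_trans)
    moreover have "lam p b q d y' f z' h = lam p P' q Q' y' y' z' z' * ?B"
      using pq PQ True le lam_split[of p b q d z' P' h y' Q' f] unfolding y z
      by (auto simp: cmp intro: order_trans)
    ultimately show "lam a p c q e y g z * lam p b q d y' f z' h =
        ?A * ?B * (bottom_coeff (P, Q) (p, q) * top_coeff (p, q) (P', Q'))"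
      by (simp add: bottom_coeff_def top_coeff_def cmp y z)
  qed
  also have "\<dots> = ?A * ?B * (\<Sum>w\<in>square.between (P, Q) (P', Q'). bottom_coeff (P, Q) w * top_coeff w (P', Q'))"
    by (simp add: sum_distrib_left)
  \<comment> \<open>The box may be empty; then \<open>(P, Q)\<close> and \<open>(P', Q')\<close>
    differ and both sides are 0.\<close>
  also have "\<dots> = (if P = P' \<and> Q = Q' then ?A * ?B else 0)"
  proof (cases "le2 (P, Q) (P', Q')")
    case True
    then show ?thesis by (subst bottom_mult_top) auto
  next
    case False
    then have "{P..P'} \<times> {Q..Q'} = {}" by (auto simp: le2_def)
    moreover have "\<not> (P = P' \<and> Q = Q')" using False by (auto simp: le2_def)
    ultimately show ?thesis by auto
  qed
  \<comment> \<open>When the cut points agree, (4) at \<open>y\<close>, \<open>z\<close> reassembles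
    \<open>?A * ?B\<close> into one coefficient.\<close>
  also have "\<dots> = (if y = y' \<and> z = z' then lam a b c d e f g h else 0)"
  proof -
    have "lam a b c d e f g h = ?A * ?B" if "P = P'" "Q = Q'"
      using that True le PQ lam_split[of a b c d g P h e Q f] unfolding y z by auto
    then show ?thesis by (auto simp: y z)
  qed
  finally show ?thesis .
qed

section \<open>Compatibility of \<open>r\<close> with comultiplication and counit\<close>

lemma comult_r: "tensor_comult inc_comult inc_comult \<circ> r = (r \<otimes>\<^sub>m r) \<circ> tensor_comult inc_comult inc_comult"
proof (rule linear_eq_on_basis[of scale])
  fix pq :: "'a intv \<times> 'a intv"
  obtain p q where pq: "pq = (p, q)" by fastforce
  let ?I = "{lower p..upper p} \<times> {lower q..upper q}"
  have "lookup (tensor_comult inc_comult inc_comult (r (basis_vec (p, q)))) ((s1, t1), (s2, t2)) =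
      lookup ((r \<otimes>\<^sub>m r) (tensor_comult inc_comult inc_comult (basis_vec (p, q)))) ((s1, t1), (s2, t2))"
    for s1 t1 s2 t2
  proof -
    have le: "upper s1 = lower s2 \<Longrightarrow> lower s1 \<le> upper s2" "upper t1 = lower t2 \<Longrightarrow> lower t1 \<le> upper t2"
      by (metis lower_le_upper order_trans)+
    have "lookup ((r \<otimes>\<^sub>m r) (tensor_comult inc_comult inc_comult (basis_vec (p, q)))) ((s1, t1), (s2, t2)) =
        (\<Sum>(u, v)\<in>?I. lam (lower p) u (lower q) v (lower s1) (upper s1) (lower t1) (upper t1) *
          lam u (upper p) v (upper q) (lower s2) (upper s2) (lower t2) (upper t2))"
      unfolding tensor_comult_basis linear_sum_on[OF linear_tensor_map] lookup_sum
      by (intro sum.cong refl) (auto simp: lookup_r)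
    also have "\<dots> = (if upper s1 = lower s2 \<and> upper t1 = lower t2 then
        lam (lower p) (upper p) (lower q) (upper q) (lower s1) (upper s2) (lower t1) (upper t2) else 0)"
      by (rule lam_convolution) (rule lower_le_upper)+
    finally show ?thesis
      using le by (auto simp: lookup_tensor_comult[OF lf] lookup_r)
  qed
  then show "(tensor_comult inc_comult inc_comult \<circ> r) (basis_vec pq) =
      ((r \<otimes>\<^sub>m r) \<circ> tensor_comult inc_comult inc_comult) (basis_vec pq)"
    by (intro poly_mapping_eqI) (auto simp: pq)
qed (intro linear_intros lin linear_tensor_comult)+

lemma counit_r: "(inc_counit \<otimes>\<^sub>f inc_counit) \<circ> r = inc_counit \<otimes>\<^sub>f inc_counit"
proof (rule linear_eq_on_basis[of "(*)"])
  fix pq :: "'a intv \<times> 'a intv"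
  obtain p q where pq: "pq = (p, q)" by fastforce
  let ?w = "r (basis_vec (p, q))" and ?h = "\<lambda>(e, g). (ivl e e, ivl g g)"
  let ?g = "\<lambda>(e, g). lam (lower p) (upper p) (lower q) (upper q) e e g g"
  let ?A = "{(e, g). ?h (e, g) \<in> keys ?w}"
  have g: "?g x = lookup ?w (?h x)" for x
    by (cases x) (simp add: lookup_r)
  have inj: "inj ?h"
    by (auto simp: inj_def dest: arg_cong[of _ _ lower])
  have fin: "finite ?A"
    using finite_vimageI[OF finite_keys inj, of ?w] by (simp add: vimage_def case_prod_unfold)
  have "(inc_counit \<otimes>\<^sub>f inc_counit) ?w =
      (\<Sum>k\<in>keys ?w. lookup ?w k * (inc_counit (basis_vec (fst k)) * inc_counit (basis_vec (snd k))))"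
    by (simp add: tensor_form_def lin_ext_def case_prod_unfold)
  \<comment> \<open>The counits keep exactly the pairs of degenerate intervals, whose coefficients
    are those summed in (0).\<close>
  also have "\<dots> = (\<Sum>k\<in>?h ` ?A. lookup ?w k)"
  proof (rule sum.mono_neutral_cong_right)
    show "\<forall>k\<in>keys ?w - ?h ` ?A.
        lookup ?w k * (inc_counit (basis_vec (fst k)) * inc_counit (basis_vec (snd k))) = 0"
    proof
      fix k assume k: "k \<in> keys ?w - ?h ` ?A"
      obtain s t where st: "k = (s, t)" by fastforce
      have "\<not> (lower s = upper s \<and> lower t = upper t)"
      proof
        assume eq: "lower s = upper s \<and> lower t = upper t"
        then have "k = ?h (lower s, lower t)"
          using ivl_lower_upper[of s] ivl_lower_upper[of t] by (simp add: st)
        with k show False by auto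
      qed
      then show "lookup ?w k * (inc_counit (basis_vec (fst k)) * inc_counit (basis_vec (snd k))) = 0"
        by (auto simp: st inc_counit_basis)
    qed
  qed (auto simp: inc_counit_basis)
  also have "\<dots> = sum ?g ?A"
    by (subst sum.reindex[OF inj_on_subset[OF inj]]) (auto simp: g intro!: sum.cong)
  also have "\<dots> = Sum_any ?g"
    using fin by (intro Sum_any.expand_superset[symmetric]) (auto simp: g in_keys_iff lookup_r)
  also have "\<dots> = (inc_counit \<otimes>\<^sub>f inc_counit) (basis_vec (p, q))"
    by (simp add: cond0 lower_le_upper inc_counit_basis)
  finally show "((inc_counit \<otimes>\<^sub>f inc_counit) \<circ> r) (basis_vec pq) =
      (inc_counit \<otimes>\<^sub>f inc_counit) (basis_vec pq)"
    by (simp add: pq)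
qed (rule Vector_Spaces.linear_compose[OF lin] linear_tensor_form)+

section \<open>Bijectivity of \<open>r\<close>\<close>

text \<open>The index of the diagonal coefficient of \<open>r\<close>, see (5).\<close>

definition leading :: "'a intv \<times> 'a intv \<Rightarrow> 'a intv \<times> 'a intv"
  where "leading = (\<lambda>(p, q). (ivl (L (lower p) (lower q)) (L (lower p) (upper q)),
    ivl (R (lower q) (lower p)) (R (lower q) (upper p))))"

lemma lookup_r_leading:
  "lookup (r (basis_vec (p, q))) (leading (p', q')) =
    lam (lower p) (upper p) (lower q) (upper q) (L (lower p') (lower q')) (L (lower p') (upper q'))
      (R (lower q') (lower p')) (R (lower q') (upper p'))"
  by (simp add: leading_def lookup_r lower_le_upper)

text \<open>The lower ends correspond under the bijection \<open>r0\<close>. Once they fix the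
  indices, the upper ends correspond under the automorphisms \<open>L a\<close> and
  \<open>R c\<close>.\<close>

lemma bij_leading: "bij leading"
proof (rule bijI)
  show "inj leading"
  proof (rule injI, clarify)
    fix p q p' q' assume "leading (p, q) = leading (p', q')"
    then have eq: "L (lower p) (lower q) = L (lower p') (lower q')"
        "L (lower p) (upper q) = L (lower p') (upper q')"
        "R (lower q) (lower p) = R (lower q') (lower p')"
        "R (lower q) (upper p) = R (lower q') (upper p')"
      by (auto simp: leading_def lower_le_upper dest: arg_cong[of _ _ lower] arg_cong[of _ _ upper])
    from r0_eqD[OF eq(1,3)] eq(2,4) show "p = p' \<and> q = q'"
      by (auto intro: intv_eqI)
  qed
  show "surj leading"
  proof (rule surjI)
    fix st :: "'a intv \<times> 'a intv"
    let ?a = "fst (inv r0 (lower (fst st), lower (snd st)))"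
      and ?c = "snd (inv r0 (lower (fst st), lower (snd st)))"
    let ?d = "inv (L ?a) (upper (fst st))" and ?b = "inv (R ?c) (upper (snd st))"
    have "r0 (?a, ?c) = (lower (fst st), lower (snd st))"
      using nondeg by (simp add: nondegenerate_bij_def surj_f_inv_f[OF bij_is_surj])
    then have "(L ?a ?c, R ?c ?a) = (lower (fst st), lower (snd st))"
      by (simp only: r0_apply)
    then have eq: "L ?a ?c = lower (fst st)" "R ?c ?a = lower (snd st)"
      by (simp_all only: prod.inject)
    \<comment> \<open>The preimages must be ordered, since \<open>ivl\<close> is meaningful only for
      ordered endpoints.\<close>
    have "L ?a ?c \<le> L ?a ?d" "R ?c ?a \<le> R ?c ?b"
      unfolding eq by (simp_all add: lower_le_upper)
    then have "?c \<le> ?d" "?a \<le> ?b" by (simp_all only: L_le_iff R_le_iff)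
    then show "leading (ivl ?a ?b, ivl ?c ?d) = st"
      by (simp add: leading_def eq)
  qed
qed

text \<open>By (3) a nonzero coefficient at \<open>leading t\<close> forces both intervals of
  \<open>t\<close> inside those of \<open>s\<close>, so the total number of points decreases unless
  \<open>t = s\<close>; there (5) applies.\<close>

lemma bij_r: "bij r"
proof (rule triangular_bij[OF lin bij_leading, of
    "\<lambda>(p, q). card {lower p..upper p} + card {lower q..upper q}"])
  show "lookup (r (basis_vec s)) (leading s) \<noteq> 0" for s
    by (cases s) (simp only: lookup_r_leading cond5 lower_le_upper not_False_eq_True)
next
  fix s t
  assume nz: "lookup (r (basis_vec s)) (leading t) \<noteq> 0" and "t \<noteq> s"
  obtain p q p' q' where st: "s = (p, q)" "t = (p', q')" by fastforce
  have bounds: "R (lower q) (lower p) \<le> R (lower q') (lower p')" "R (lower q') (upper p') \<le> R (lower q) (upper p)"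
    "L (lower p) (lower q) \<le> L (lower p') (lower q')" "L (lower p') (upper q') \<le> L (lower p) (upper q)"
    using nz cond3[OF lower_le_upper[of p] lower_le_upper[of q], of
        "L (lower p') (lower q')" "L (lower p') (upper q')" "R (lower q') (lower p')" "R (lower q') (upper p')"]
    unfolding st lookup_r_leading by (auto simp: lower_le_upper)
  \<comment> \<open>The bounds compare values of \<open>L\<close> and \<open>R\<close> with
    different indices. The lower ends of \<open>leading t\<close> are pulled back with the indices
    of \<open>s\<close>; by (2), \<open>r0\<close> agrees at \<open>(z, x)\<close> and
    \<open>(lower p', lower q')\<close>, so these pairs coincide by injectivity.\<close>
  define x where "x = inv (L (lower p)) (L (lower p') (lower q'))"
  define z where "z = inv (R (lower q)) (R (lower q') (lower p'))"
  have eq: "L (lower p') (lower q') = L (lower p) x" "R (lower q') (lower p') = R (lower q) z"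
    by (simp_all add: x_def z_def)
  have xz: "lower q \<le> x" "lower p \<le> z"
    using bounds(1,3) unfolding eq by simp_all
  have "L z x = L (lower p') (lower q')" "R x z = R (lower q') (lower p')"
    using L_comparable[OF xz(2)] R_comparable[OF xz(1)] eq by simp_all
  then have "lower p \<le> lower p'" "lower q \<le> lower q'"
    using r0_eqD xz by blast+
  moreover from this have "upper p' \<le> upper p" "upper q' \<le> upper q"
    using bounds(2,4) L_comparable R_comparable by (metis L_le_iff R_le_iff)+
  moreover have "p' \<noteq> p \<or> q' \<noteq> q"
    using \<open>t \<noteq> s\<close> by (auto simp: st)
  ultimately show "(\<lambda>(p, q). card {lower p..upper p} + card {lower q..upper q}) t
      < (\<lambda>(p, q). card {lower p..upper p} + card {lower q..upper q}) s"
    using card_subinterval_le[OF lf, of p p'] card_subinterval_less[OF lf, of p p']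
      card_subinterval_le[OF lf, of q q'] card_subinterval_less[OF lf, of q q']
    by (fastforce simp: st)
qed

section \<open>Bijectivity of \<sigma> and \<tau> with one argument degenerate, and
  non-degeneracy\<close>

lemma lookup_sigma:
  "lookup ((id \<otimes>\<^sub>r inc_counit) (r (basis_vec (ivl a a, q)))) s =
    lam a a (lower q) (upper q) (lower s) (upper s) (R (lower q) a) (R (lower q) a)"
proof -
  have "lookup ((id \<otimes>\<^sub>r inc_counit) (r (basis_vec (ivl a a, q)))) s =
      lookup (r (basis_vec (ivl a a, q))) (s, ivl (R (lower q) a) (R (lower q) a))"
  proof (rule lookup_tensor_map_form_counit)
    \<comment> \<open>A degenerate first argument makes the bounds in (3) on \<open>t\<close>
      collapse to the point \<open>R (lower q) a\<close>.\<close>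
    fix s t assume "lookup (r (basis_vec (ivl a a, q))) (s, t) \<noteq> 0"
    with cond3[OF order_refl lower_le_upper[of q] lower_le_upper[of s] lower_le_upper[of t], of a]
    have "lower t = R (lower q) a" "upper t = R (lower q) a"
      by (auto simp: lookup_r intro: order.antisym order_trans)
    then show "t = ivl (R (lower q) a) (R (lower q) a)"
      by (intro intv_eqI) simp_all
  qed simp
  then show ?thesis by (simp add: lookup_r)
qed

lemma lookup_tau:
  "lookup ((inc_counit \<otimes>\<^sub>l id) (r (basis_vec (p, ivl c c)))) t =
    lam (lower p) (upper p) c c (L (lower p) c) (L (lower p) c) (lower t) (upper t)"
proof -
  have "lookup ((inc_counit \<otimes>\<^sub>l id) (r (basis_vec (p, ivl c c)))) t =
      lookup (r (basis_vec (p, ivl c c))) (ivl (L (lower p) c) (L (lower p) c), t)"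
  proof (rule lookup_tensor_form_map_counit)
    fix s t assume "lookup (r (basis_vec (p, ivl c c))) (s, t) \<noteq> 0"
    with cond3[OF lower_le_upper[of p] order_refl lower_le_upper[of s] lower_le_upper[of t], of c]
    have "lower s = L (lower p) c" "upper s = L (lower p) c"
      by (auto simp: lookup_r intro: order.antisym order_trans)
    then show "s = ivl (L (lower p) c) (L (lower p) c)"
      by (intro intv_eqI) simp_all
  qed simp
  then show ?thesis by (simp add: lookup_r)
qed

text \<open>Triangularity along the bijection of intervals induced by \<open>L a\<close>: (3) puts
  every other contributing interval strictly inside \<open>q\<close>, and (5) gives the
  diagonal.\<close>

lemma bij_sigma: "bij (\<lambda>v. ((id \<otimes>\<^sub>r inc_counit) \<circ> r) (basis_vec (ivl a a) \<otimes> v))"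
proof (rule triangular_bij[OF _ bij_map_intv[OF cond1[THEN conjunct1]], where m = "\<lambda>q. card {lower q..upper q}"])
  show "linear_map (\<lambda>v. ((id \<otimes>\<^sub>r inc_counit) \<circ> r) (basis_vec (ivl a a) \<otimes> v))"
    by (rule linear_map_comp[OF linear_tensor_right linear_map_comp[OF lin linear_tensor_map_form],
          unfolded o_def[of _ "(\<otimes>) _"]])
  show "lookup (((id \<otimes>\<^sub>r inc_counit) \<circ> r) (basis_vec (ivl a a) \<otimes> basis_vec q))
      (ivl (L a (lower q)) (L a (upper q))) \<noteq> 0" for q
    using cond5[OF order_refl lower_le_upper[of q], of a]
    by (simp add: lookup_sigma lower_le_upper)
  fix q t
  assume "lookup (((id \<otimes>\<^sub>r inc_counit) \<circ> r) (basis_vec (ivl a a) \<otimes> basis_vec q))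
      (ivl (L a (lower t)) (L a (upper t))) \<noteq> 0" and "t \<noteq> q"
  with cond3[OF order_refl lower_le_upper[of q], of "L a (lower t)" "L a (upper t)" _ _ a]
  show "card {lower t..upper t} < card {lower q..upper q}"
    by (intro card_subinterval_less[OF lf]) (auto simp: lookup_sigma lower_le_upper)
qed

lemma bij_tau: "bij (\<lambda>v. ((inc_counit \<otimes>\<^sub>l id) \<circ> r) (v \<otimes> basis_vec (ivl c c)))"
proof (rule triangular_bij[OF _ bij_map_intv[OF cond1[THEN conjunct2]], where m = "\<lambda>q. card {lower q..upper q}"])
  show "linear_map (\<lambda>v. ((inc_counit \<otimes>\<^sub>l id) \<circ> r) (v \<otimes> basis_vec (ivl c c)))"
    by (rule linear_map_comp[OF linear_tensor_left linear_map_comp[OF lin linear_tensor_form_map],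
          unfolded o_def[of _ "\<lambda>v. v \<otimes> _"]])
  show "lookup (((inc_counit \<otimes>\<^sub>l id) \<circ> r) (basis_vec p \<otimes> basis_vec (ivl c c)))
      (ivl (R c (lower p)) (R c (upper p))) \<noteq> 0" for p
    using cond5[OF lower_le_upper[of p] order_refl, of c]
    by (simp add: lookup_tau lower_le_upper)
  fix p t
  assume "lookup (((inc_counit \<otimes>\<^sub>l id) \<circ> r) (basis_vec p \<otimes> basis_vec (ivl c c)))
      (ivl (R c (lower t)) (R c (upper t))) \<noteq> 0" and "t \<noteq> p"
  with cond3[OF lower_le_upper[of p] order_refl, of _ _ "R c (lower t)" "R c (upper t)" c]
  show "card {lower t..upper t} < card {lower p..upper p}"
    by (intro card_subinterval_less[OF lf]) (auto simp: lookup_tau lower_le_upper)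
qed

lemma coalgebra_automorphism_r:
  "coalgebra_automorphism (tensor_comult inc_comult inc_comult) (inc_counit \<otimes>\<^sub>f inc_counit) r"
  using lin comult_r counit_r bij_r by (simp add: coalgebra_automorphism_def coalgebra_hom_def)

lemma nondegenerate_r: "nondegenerate inc_comult inc_counit r"
proof -
  obtain \<sigma>' where "linear_map \<sigma>'"
    "\<sigma>' \<circ> (id \<otimes>\<^sub>m ((id \<otimes>\<^sub>r inc_counit) \<circ> r)) \<circ> tensor_assoc \<circ> (inc_comult \<otimes>\<^sub>m id) = inc_counit \<otimes>\<^sub>l id"
    "((id \<otimes>\<^sub>r inc_counit) \<circ> r) \<circ> (id \<otimes>\<^sub>m \<sigma>') \<circ> tensor_assoc \<circ> (inc_comult \<otimes>\<^sub>m id) = inc_counit \<otimes>\<^sub>l id"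
    using left_convolution_inverse[OF lf linear_map_comp[OF lin linear_tensor_map_form] bij_sigma] by blast
  moreover obtain \<tau>' where "linear_map \<tau>'"
    "\<tau>' \<circ> (((inc_counit \<otimes>\<^sub>l id) \<circ> r) \<otimes>\<^sub>m id) \<circ> tensor_assoc' \<circ> (id \<otimes>\<^sub>m inc_comult) = id \<otimes>\<^sub>r inc_counit"
    "((inc_counit \<otimes>\<^sub>l id) \<circ> r) \<circ> (\<tau>' \<otimes>\<^sub>m id) \<circ> tensor_assoc' \<circ> (id \<otimes>\<^sub>m inc_comult) = id \<otimes>\<^sub>r inc_counit"
    using right_convolution_inverse[OF lf linear_map_comp[OF lin linear_tensor_form_map] bij_tau] by blast
  ultimately show ?thesis
    unfolding nondegenerate_def Let_def by blast
qed

end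

theorem theorem3p4:
  fixes r :: "('a::order intv \<times> 'a intv \<Rightarrow>\<^sub>0 'k::field) \<Rightarrow> ('a intv \<times> 'a intv \<Rightarrow>\<^sub>0 'k)"
    and r0 :: "'a \<times> 'a \<Rightarrow> 'a \<times> 'a"
    and L R :: "'a \<Rightarrow> 'a \<Rightarrow> 'a"
    and lam :: "'a \<Rightarrow> 'a \<Rightarrow> 'a \<Rightarrow> 'a \<Rightarrow> 'a \<Rightarrow> 'a \<Rightarrow> 'a \<Rightarrow> 'a \<Rightarrow> 'k"
  defines "L \<equiv> left_map r0" and "R \<equiv> right_map r0" and "lam \<equiv> coefficient r"
  assumes "locally_finite TYPE('a)"
    and "linear_map r"
    and "induces_by_restriction r r0"
    and "nondegenerate_bij r0"
    and cond0: "\<And>a b c d. a \<le> b \<Longrightarrow> c \<le> d \<Longrightarrow>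
      (\<Sum>(e, g). lam a b c d e e g g) = (if a = b then 1 else 0) * (if c = d then 1 else 0)"
    and cond1: "\<And>a b. order_automorphism (L a) \<and> order_automorphism (R b)"
    and cond2: "\<And>a b. same_component a b \<Longrightarrow> L a = L b \<and> R a = R b"
    and cond3: "\<And>a b c d e f g h.
      a \<le> b \<Longrightarrow> c \<le> d \<Longrightarrow> e \<le> f \<Longrightarrow> g \<le> h \<Longrightarrow> lam a b c d e f g h \<noteq> 0 \<Longrightarrow>
      R c a \<le> g \<and> g \<le> h \<and> h \<le> R c b \<and> L a c \<le> e \<and> e \<le> f \<and> f \<le> L a d"
    and cond4: "\<And>a b c d e f g h y z.
      a \<le> b \<Longrightarrow> c \<le> d \<Longrightarrow> e \<le> f \<Longrightarrow> g \<le> h \<Longrightarrow>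
      R c a \<le> g \<Longrightarrow> h \<le> R c b \<Longrightarrow> L a c \<le> e \<Longrightarrow> f \<le> L a d \<Longrightarrow>
      e \<le> y \<Longrightarrow> y \<le> f \<Longrightarrow> g \<le> z \<Longrightarrow> z \<le> h \<Longrightarrow>
      lam a b c d e f g h =
        lam a (inv (R c) z) c (inv (L a) y) e y g z *
        lam (inv (R c) z) b (inv (L a) y) d y f z h"
    and cond5: "\<And>a b c d. a \<le> b \<Longrightarrow> c \<le> d \<Longrightarrow>
      lam a b c d (L a c) (L a d) (R c a) (R c b) \<noteq> 0"
  shows "coalgebra_automorphism
           (tensor_comult inc_comult inc_comult) (inc_counit \<otimes>\<^sub>f inc_counit) r
       \<and> nondegenerate inc_comult inc_counit r"
proof -
  interpret restricted_endomorphism r r0 L R lam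
    by (rule restricted_endomorphism.intro; (unfold L_def R_def lam_def)?)
      (rule refl, rule refl, rule refl, fact assms(4), fact assms(5), fact assms(6), fact assms(7),
        fact cond0[unfolded L_def R_def lam_def], fact cond1[unfolded L_def R_def lam_def],
        fact cond2[unfolded L_def R_def lam_def], fact cond3[unfolded L_def R_def lam_def],
        fact cond4[unfolded L_def R_def lam_def], fact cond5[unfolded L_def R_def lam_def])
  show ?thesis
    using coalgebra_automorphism_r nondegenerate_r by blast
qed

end
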